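(* The inclusion $(Q_bA)\subset(QA)$ is strict, and $\operatorname{rad}_n<\operatorname{rad}_b$ on $(QA)$; that is, $\operatorname{rad}_n(A)\subset\operatorname{rad}_b(A)$ for every $A\in(QA)$, and the inclusion is strict for some $A\in(QA)$.
   Context: All algebras are complex and associative. The unitization $A^1$ of $A$ is $A$ itself if $A$ is unital and $A\oplus\mathbb{C}$ with the standard operations and norm otherwise. A representation of $A$ on a vector space $X$ is strictly irreducible if it is nonzero and $X$ has no invariant linear subspaces other than $0$ and $X$. Two strictly irreducible representations $\pi,\tau$ of $A$ on $X_\pi,X_\tau$ are equivalent if there is a linear isomorphism $T:X_\pi\to X_\tau$ with $\tau(a)T=T\pi(a)$ for all $a\in A$. A representation $\pi$ of a normed algebra $A$ on a normed space $X$ by bounded operators is continuous if $\pi:A\to B(X)$ is a bounded linear map. $(QA)$ is the class of all normed algebras $A$ such that the set of invertible elements of $A^1$ is open ($Q$-algebras). $(Q_bA)$ is the class of all normed algebras each of whose strictly irreducible representations is equivalent to a continuous representation by bounded operators on a Banach space. For a normed algebra $A$, $\operatorname{rad}_b(A)$ (resp. $\operatorname{rad}_n(A)$) is the intersection of the kernels of all continuous strictly irreducible representations of $A^1$ by bounded operators on Banach (resp. normed) spaces (an empty intersection being the whole algebra). *)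

theory Defs
  imports "HOL-Analysis.Abstract_Metric_Spaces" "HOL-Algebra.Module"
begin

text \<open>
  The statement quantifies existentially over normed algebras and over representation spaces, so
  all structures have explicit carriers. Vector spaces are the modules of HOL-Algebra over the
  field of complex numbers.
\<close>

definition complex_field :: "complex ring"
  where "complex_field = \<lparr>carrier = UNIV, mult = (*), one = 1, zero = 0, add = (+)\<rparr>"

lemma cring_complex_field: "cring complex_field"
proof -
  have "\<exists>y. x + y = 0 \<and> y + x = 0" for x :: complex
    by (rule exI[of _ "- x"]) simp
  then show ?thesis
    by unfold_locales (auto simp: complex_field_def algebra_simps Units_def)
qed

text \<open>
  The fields \<open>mult\<close> and \<open>one\<close> inherited from \<open>ring\<close> play no role for mere vector spaces, and
  \<open>one\<close> plays no role for a normed algebra, which need not have a unit.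
\<close>

record 'a normed = "(complex, 'a) module" +
  nrm :: "'a \<Rightarrow> real"

locale normed_space = module complex_field X for X :: "'x normed" (structure) +
  assumes nrm_eq_0_iff: "x \<in> carrier X \<Longrightarrow> nrm X x = 0 \<longleftrightarrow> x = \<zero>\<^bsub>X\<^esub>"
    and nrm_add_le: "\<lbrakk>x \<in> carrier X; y \<in> carrier X\<rbrakk> \<Longrightarrow> nrm X (x \<oplus>\<^bsub>X\<^esub> y) \<le> nrm X x + nrm X y"
    and nrm_smult: "x \<in> carrier X \<Longrightarrow> nrm X (c \<odot>\<^bsub>X\<^esub> x) = cmod c * nrm X x"

locale normed_algebra = normed_space A for A :: "'a normed" (structure) +
  assumes mult_closed: "\<lbrakk>a \<in> carrier A; b \<in> carrier A\<rbrakk> \<Longrightarrow> a \<otimes>\<^bsub>A\<^esub> b \<in> carrier A"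
    and mult_assoc: "\<lbrakk>a \<in> carrier A; b \<in> carrier A; c \<in> carrier A\<rbrakk>
      \<Longrightarrow> (a \<otimes>\<^bsub>A\<^esub> b) \<otimes>\<^bsub>A\<^esub> c = a \<otimes>\<^bsub>A\<^esub> (b \<otimes>\<^bsub>A\<^esub> c)"
    and mult_l_distr: "\<lbrakk>a \<in> carrier A; b \<in> carrier A; c \<in> carrier A\<rbrakk>
      \<Longrightarrow> (a \<oplus>\<^bsub>A\<^esub> b) \<otimes>\<^bsub>A\<^esub> c = a \<otimes>\<^bsub>A\<^esub> c \<oplus>\<^bsub>A\<^esub> b \<otimes>\<^bsub>A\<^esub> c"
    and mult_r_distr: "\<lbrakk>a \<in> carrier A; b \<in> carrier A; c \<in> carrier A\<rbrakk>
      \<Longrightarrow> a \<otimes>\<^bsub>A\<^esub> (b \<oplus>\<^bsub>A\<^esub> c) = a \<otimes>\<^bsub>A\<^esub> b \<oplus>\<^bsub>A\<^esub> a \<otimes>\<^bsub>A\<^esub> c"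
    and smult_mult: "\<lbrakk>a \<in> carrier A; b \<in> carrier A\<rbrakk>
      \<Longrightarrow> (s \<odot>\<^bsub>A\<^esub> a) \<otimes>\<^bsub>A\<^esub> b = s \<odot>\<^bsub>A\<^esub> (a \<otimes>\<^bsub>A\<^esub> b)"
    and mult_smult: "\<lbrakk>a \<in> carrier A; b \<in> carrier A\<rbrakk>
      \<Longrightarrow> a \<otimes>\<^bsub>A\<^esub> (s \<odot>\<^bsub>A\<^esub> b) = s \<odot>\<^bsub>A\<^esub> (a \<otimes>\<^bsub>A\<^esub> b)"
    and nrm_mult_le: "\<lbrakk>a \<in> carrier A; b \<in> carrier A\<rbrakk> \<Longrightarrow> nrm A (a \<otimes>\<^bsub>A\<^esub> b) \<le> nrm A a * nrm A b"

text \<open>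
  \<open>Metric_space\<close> requires a distance that is nonnegative and symmetric on the whole type, hence the
  value 0 off the carrier.
\<close>

definition norm_dist :: "'x normed \<Rightarrow> 'x \<Rightarrow> 'x \<Rightarrow> real"
  where "norm_dist X x y =
    (if x \<in> carrier X \<and> y \<in> carrier X then nrm X (x \<ominus>\<^bsub>X\<^esub> y) else 0)"

lemma (in normed_space) nrm_minus_commute:
  assumes "x \<in> carrier X" "y \<in> carrier X"
  shows "nrm X (x \<ominus>\<^bsub>X\<^esub> y) = nrm X (y \<ominus>\<^bsub>X\<^esub> x)"
proof -
  have neg: "\<ominus>\<^bsub>X\<^esub> z = (- 1) \<odot>\<^bsub>X\<^esub> z" if "z \<in> carrier X" for z
  proof -
    have "(- 1) \<odot>\<^bsub>X\<^esub> z \<oplus>\<^bsub>X\<^esub> z = (- 1 + 1) \<odot>\<^bsub>X\<^esub> z"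
      using smult_l_distr[of "- 1" 1 z] smult_one[of z] that by (simp add: complex_field_def)
    also have "\<dots> = \<zero>\<^bsub>X\<^esub>"
      using smult_l_null[of z] that by (simp add: complex_field_def)
    finally show ?thesis
      using that smult_closed[of "- 1" z] by (simp add: complex_field_def minus_equality)
  qed
  have "y \<ominus>\<^bsub>X\<^esub> x = \<ominus>\<^bsub>X\<^esub> (x \<ominus>\<^bsub>X\<^esub> y)"
    using assms by (simp add: a_minus_def minus_add a_comm)
  then show ?thesis
    using assms neg[of "x \<ominus>\<^bsub>X\<^esub> y"] nrm_smult[of "x \<ominus>\<^bsub>X\<^esub> y" "- 1"] by simp
qed

lemma (in normed_space) nrm_nonneg:
  assumes "x \<in> carrier X"
  shows "0 \<le> nrm X x"
proof -
  have "x \<ominus>\<^bsub>X\<^esub> x = \<zero>\<^bsub>X\<^esub>"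
    using assms by (simp add: a_minus_def r_neg)
  moreover have "nrm X (\<ominus>\<^bsub>X\<^esub> x) = nrm X x"
    using nrm_minus_commute[of x "\<zero>\<^bsub>X\<^esub>"] assms minus_equality[of "\<zero>\<^bsub>X\<^esub>" "\<zero>\<^bsub>X\<^esub>"]
    by (simp add: a_minus_def)
  ultimately show ?thesis
    using nrm_add_le[of x "\<ominus>\<^bsub>X\<^esub> x"] nrm_eq_0_iff[of "\<zero>\<^bsub>X\<^esub>"] assms by (simp add: a_minus_def)
qed

lemma (in normed_space) Metric_space_norm_dist: "Metric_space (carrier X) (norm_dist X)"
proof
  fix x y
  show "0 \<le> norm_dist X x y"
    by (simp add: norm_dist_def nrm_nonneg)
  show "norm_dist X x y = norm_dist X y x"
    by (simp add: norm_dist_def nrm_minus_commute)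
next
  fix x y assume "x \<in> carrier X" "y \<in> carrier X"
  moreover from this have "x \<ominus>\<^bsub>X\<^esub> y = \<zero>\<^bsub>X\<^esub> \<longleftrightarrow> x = y"
    by (metis a_minus_def a_inv_closed minus_equality minus_minus r_neg)
  ultimately show "norm_dist X x y = 0 \<longleftrightarrow> x = y"
    by (simp add: norm_dist_def nrm_eq_0_iff)
next
  fix x y z assume xyz: "x \<in> carrier X" "y \<in> carrier X" "z \<in> carrier X"
  have "(x \<ominus>\<^bsub>X\<^esub> y) \<oplus>\<^bsub>X\<^esub> (y \<ominus>\<^bsub>X\<^esub> z) = x \<ominus>\<^bsub>X\<^esub> z"
    using xyz by (simp add: a_minus_def a_assoc r_neg1)
  then show "norm_dist X x z \<le> norm_dist X x y + norm_dist X y z"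
    using nrm_add_le[of "x \<ominus>\<^bsub>X\<^esub> y" "y \<ominus>\<^bsub>X\<^esub> z"] xyz by (simp add: norm_dist_def)
qed

definition norm_metric :: "'x normed \<Rightarrow> 'x metric"
  where "norm_metric X = metric (carrier X, norm_dist X)"

definition banach_space :: "'x normed \<Rightarrow> bool"
  where "banach_space X \<longleftrightarrow> normed_space X \<and> mcomplete_of (norm_metric X)"


subsection \<open>Unitization and Q-algebras\<close>

definition is_unit_of :: "'a normed \<Rightarrow> 'a \<Rightarrow> bool"
  where "is_unit_of A e \<longleftrightarrow>
    e \<in> carrier A \<and> (\<forall>a\<in>carrier A. e \<otimes>\<^bsub>A\<^esub> a = a \<and> a \<otimes>\<^bsub>A\<^esub> e = a)"

definition unital :: "'a normed \<Rightarrow> bool"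
  where "unital A \<longleftrightarrow> (\<exists>e. is_unit_of A e)"

text \<open>
  The pair \<open>(a, s)\<close> stands for \<open>a + s1\<close>. If \<open>A\<close> is unital, then the unitization is \<open>A\<close> itself, which
  appears here as its isometric copy \<open>carrier A \<times> {0}\<close>, to have one type for both cases.
\<close>

definition unitization :: "'a normed \<Rightarrow> ('a \<times> complex) normed"
  where "unitization A =
    \<lparr>carrier = carrier A \<times> (if unital A then {0} else UNIV),
     mult = (\<lambda>(a, s) (b, t). (a \<otimes>\<^bsub>A\<^esub> b \<oplus>\<^bsub>A\<^esub> (s \<odot>\<^bsub>A\<^esub> b \<oplus>\<^bsub>A\<^esub> t \<odot>\<^bsub>A\<^esub> a), s * t)),
     one = (if unital A then (THE e. is_unit_of A e, 0) else (\<zero>\<^bsub>A\<^esub>, 1)),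
     zero = (\<zero>\<^bsub>A\<^esub>, 0),
     add = (\<lambda>(a, s) (b, t). (a \<oplus>\<^bsub>A\<^esub> b, s + t)),
     smult = (\<lambda>c (a, s). (c \<odot>\<^bsub>A\<^esub> a, c * s)),
     nrm = (\<lambda>(a, s). nrm A a + cmod s)\<rparr>"

lemma (in normed_algebra) normed_algebra_unitization: "normed_algebra (unitization A)"
proof -
  let ?U = "unitization A"
  have scl: "s \<odot>\<^bsub>A\<^esub> a \<in> carrier A" if "a \<in> carrier A" for s a
    using smult_closed[of s a] that by (simp add: complex_field_def)
  have sl: "(s + t) \<odot>\<^bsub>A\<^esub> a = s \<odot>\<^bsub>A\<^esub> a \<oplus>\<^bsub>A\<^esub> t \<odot>\<^bsub>A\<^esub> a"
    and sa: "(s * t) \<odot>\<^bsub>A\<^esub> a = s \<odot>\<^bsub>A\<^esub> (t \<odot>\<^bsub>A\<^esub> a)"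
    and s1: "1 \<odot>\<^bsub>A\<^esub> a = a" if "a \<in> carrier A" for s t a
    using smult_l_distr[of s t a] smult_assoc1[of s t a] smult_one[of a] that
    by (simp_all add: complex_field_def)
  have sr: "s \<odot>\<^bsub>A\<^esub> (a \<oplus>\<^bsub>A\<^esub> b) = s \<odot>\<^bsub>A\<^esub> a \<oplus>\<^bsub>A\<^esub> s \<odot>\<^bsub>A\<^esub> b"
    if "a \<in> carrier A" "b \<in> carrier A" for s a b
    using smult_r_distr[of s a b] that by (simp add: complex_field_def)
  note cl = scl mult_closed
  have car: "fst x \<in> carrier A" "unital A \<Longrightarrow> snd x = 0" if "x \<in> carrier ?U" for x
    using that by (auto simp: unitization_def split: if_splits)
  have mem: "x \<in> carrier ?U" if "fst x \<in> carrier A" "unital A \<Longrightarrow> snd x = 0" for x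
    using that by (auto simp: unitization_def mem_Times_iff)
  have ops: "x \<oplus>\<^bsub>?U\<^esub> y = (fst x \<oplus>\<^bsub>A\<^esub> fst y, snd x + snd y)"
    "x \<otimes>\<^bsub>?U\<^esub> y = (fst x \<otimes>\<^bsub>A\<^esub> fst y \<oplus>\<^bsub>A\<^esub> (snd x \<odot>\<^bsub>A\<^esub> fst y \<oplus>\<^bsub>A\<^esub> snd y \<odot>\<^bsub>A\<^esub> fst x), snd x * snd y)"
    "c \<odot>\<^bsub>?U\<^esub> x = (c \<odot>\<^bsub>A\<^esub> fst x, c * snd x)" "\<zero>\<^bsub>?U\<^esub> = (\<zero>\<^bsub>A\<^esub>, 0)"
    "nrm ?U x = nrm A (fst x) + cmod (snd x)" for c x y
    by (simp_all add: unitization_def case_prod_beta)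
  have "module complex_field ?U"
  proof (rule moduleI)
    show "cring complex_field"
      by (rule cring_complex_field)
    show "abelian_group ?U"
    proof (rule abelian_groupI)
      show "\<exists>y\<in>carrier ?U. y \<oplus>\<^bsub>?U\<^esub> x = \<zero>\<^bsub>?U\<^esub>" if x: "x \<in> carrier ?U" for x
        by (rule bexI[of _ "(\<ominus>\<^bsub>A\<^esub> fst x, - snd x)"])
          (use car[OF x] in \<open>auto intro!: mem simp: ops l_neg\<close>)
      show "x \<oplus>\<^bsub>?U\<^esub> y = y \<oplus>\<^bsub>?U\<^esub> x" if "x \<in> carrier ?U" "y \<in> carrier ?U" for x y
        using car that by (simp add: ops a_comm)
      show "x \<oplus>\<^bsub>?U\<^esub> y \<in> carrier ?U" if "x \<in> carrier ?U" "y \<in> carrier ?U" for x y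
        using car[OF that(1)] car[OF that(2)] by (intro mem) (simp_all add: ops)
    qed (use car in \<open>auto intro!: mem simp: ops a_assoc\<close>)
  qed (use car in \<open>auto intro!: mem simp: ops cl sl sa s1 sr complex_field_def algebra_simps\<close>)
  moreover have "normed_space_axioms ?U"
  proof
    fix x y c assume x: "x \<in> carrier ?U"
    show "nrm ?U x = 0 \<longleftrightarrow> x = \<zero>\<^bsub>?U\<^esub>"
      using car(1)[OF x] nrm_nonneg[of "fst x"] nrm_eq_0_iff[of "fst x"]
      by (auto simp: ops prod_eq_iff add_nonneg_eq_0_iff)
    show "nrm ?U (c \<odot>\<^bsub>?U\<^esub> x) = cmod c * nrm ?U x"
      using car(1)[OF x] by (simp add: ops nrm_smult norm_mult algebra_simps)
    assume y: "y \<in> carrier ?U"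
    show "nrm ?U (x \<oplus>\<^bsub>?U\<^esub> y) \<le> nrm ?U x + nrm ?U y"
      using nrm_add_le[OF car(1)[OF x] car(1)[OF y]] norm_triangle_ineq[of "snd x" "snd y"]
      by (simp add: ops)
  qed
  moreover have "normed_algebra_axioms ?U"
  proof
    fix x y z s assume x: "x \<in> carrier ?U" and y: "y \<in> carrier ?U"
    note X = car[OF x] and Y = car[OF y]
    show "x \<otimes>\<^bsub>?U\<^esub> y \<in> carrier ?U"
      using X Y by (auto intro!: mem simp: ops cl)
    show "(s \<odot>\<^bsub>?U\<^esub> x) \<otimes>\<^bsub>?U\<^esub> y = s \<odot>\<^bsub>?U\<^esub> (x \<otimes>\<^bsub>?U\<^esub> y)"
      "x \<otimes>\<^bsub>?U\<^esub> (s \<odot>\<^bsub>?U\<^esub> y) = s \<odot>\<^bsub>?U\<^esub> (x \<otimes>\<^bsub>?U\<^esub> y)"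
      using X(1) Y(1)
      by (simp_all add: ops cl sr smult_mult mult_smult sa[symmetric] mult.commute)
    show "nrm ?U (x \<otimes>\<^bsub>?U\<^esub> y) \<le> nrm ?U x * nrm ?U y"
    proof -
      let ?a = "fst x" and ?b = "fst y"
      have "nrm A (?a \<otimes>\<^bsub>A\<^esub> ?b \<oplus>\<^bsub>A\<^esub> (snd x \<odot>\<^bsub>A\<^esub> ?b \<oplus>\<^bsub>A\<^esub> snd y \<odot>\<^bsub>A\<^esub> ?a)) \<le>
        nrm A (?a \<otimes>\<^bsub>A\<^esub> ?b) + nrm A (snd x \<odot>\<^bsub>A\<^esub> ?b \<oplus>\<^bsub>A\<^esub> snd y \<odot>\<^bsub>A\<^esub> ?a)"
        using X(1) Y(1) by (intro nrm_add_le) (simp_all add: cl)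
      also have "\<dots> \<le> nrm A ?a * nrm A ?b + (nrm A (snd x \<odot>\<^bsub>A\<^esub> ?b) + nrm A (snd y \<odot>\<^bsub>A\<^esub> ?a))"
        using X(1) Y(1) by (intro add_mono nrm_mult_le nrm_add_le) (simp_all add: cl)
      finally show ?thesis
        using X(1) Y(1) by (simp add: ops nrm_smult norm_mult algebra_simps)
    qed
    assume z: "z \<in> carrier ?U"
    note Z = car[OF z]
    show "(x \<otimes>\<^bsub>?U\<^esub> y) \<otimes>\<^bsub>?U\<^esub> z = x \<otimes>\<^bsub>?U\<^esub> (y \<otimes>\<^bsub>?U\<^esub> z)"
      using X(1) Y(1) Z(1)
      by (simp add: ops cl sr sa[symmetric] mult_l_distr mult_r_distr smult_mult mult_smult
          mult_assoc a_ac mult.commute mult.left_commute)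
    show "(x \<oplus>\<^bsub>?U\<^esub> y) \<otimes>\<^bsub>?U\<^esub> z = x \<otimes>\<^bsub>?U\<^esub> z \<oplus>\<^bsub>?U\<^esub> y \<otimes>\<^bsub>?U\<^esub> z"
      "x \<otimes>\<^bsub>?U\<^esub> (y \<oplus>\<^bsub>?U\<^esub> z) = x \<otimes>\<^bsub>?U\<^esub> y \<oplus>\<^bsub>?U\<^esub> x \<otimes>\<^bsub>?U\<^esub> z"
      using X(1) Y(1) Z(1)
      by (simp_all add: ops cl sl sr mult_l_distr mult_r_distr a_ac algebra_simps)
  qed
  ultimately show ?thesis
    by (simp add: normed_algebra_def normed_space_def)
qed

definition Q_algebras :: "'a normed set"
  where "Q_algebras = {A. normed_algebra A \<and>
    openin (mtopology_of (norm_metric (unitization A))) (Units (unitization A))}"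


subsection \<open>Representations\<close>

definition linear_between ::
    "(complex, 'x, 'm) module_scheme \<Rightarrow> (complex, 'y, 'n) module_scheme \<Rightarrow> ('x \<Rightarrow> 'y) \<Rightarrow> bool"
  where "linear_between X Y T \<longleftrightarrow>
    T ` carrier X \<subseteq> carrier Y \<and>
    (\<forall>x\<in>carrier X. \<forall>y\<in>carrier X. T (x \<oplus>\<^bsub>X\<^esub> y) = T x \<oplus>\<^bsub>Y\<^esub> T y) \<and>
    (\<forall>c. \<forall>x\<in>carrier X. T (c \<odot>\<^bsub>X\<^esub> x) = c \<odot>\<^bsub>Y\<^esub> T x)"

definition representation ::
    "'a normed \<Rightarrow> (complex, 'x, 'm) module_scheme \<Rightarrow> ('a \<Rightarrow> 'x \<Rightarrow> 'x) \<Rightarrow> bool"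
  where "representation A X \<pi> \<longleftrightarrow>
    module complex_field X \<and>
    (\<forall>a\<in>carrier A. linear_between X X (\<pi> a)) \<and>
    (\<forall>a\<in>carrier A. \<forall>b\<in>carrier A. \<forall>x\<in>carrier X.
      \<pi> (a \<oplus>\<^bsub>A\<^esub> b) x = \<pi> a x \<oplus>\<^bsub>X\<^esub> \<pi> b x \<and> \<pi> (a \<otimes>\<^bsub>A\<^esub> b) x = \<pi> a (\<pi> b x)) \<and>
    (\<forall>c. \<forall>a\<in>carrier A. \<forall>x\<in>carrier X. \<pi> (c \<odot>\<^bsub>A\<^esub> a) x = c \<odot>\<^bsub>X\<^esub> \<pi> a x)"

definition rep_kernel ::
    "'a normed \<Rightarrow> (complex, 'x, 'm) module_scheme \<Rightarrow> ('a \<Rightarrow> 'x \<Rightarrow> 'x) \<Rightarrow> 'a set"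
  where "rep_kernel A X \<pi> = {a \<in> carrier A. \<forall>x\<in>carrier X. \<pi> a x = \<zero>\<^bsub>X\<^esub>}"

definition strictly_irreducible ::
    "'a normed \<Rightarrow> (complex, 'x, 'm) module_scheme \<Rightarrow> ('a \<Rightarrow> 'x \<Rightarrow> 'x) \<Rightarrow> bool"
  where "strictly_irreducible A X \<pi> \<longleftrightarrow>
    representation A X \<pi> \<and> rep_kernel A X \<pi> \<noteq> carrier A \<and>
    (\<forall>E. submodule E complex_field X \<and> (\<forall>a\<in>carrier A. \<pi> a ` E \<subseteq> E)
      \<longrightarrow> E = {\<zero>\<^bsub>X\<^esub>} \<or> E = carrier X)"

definition equivalent_reps ::
    "'a normed \<Rightarrow> (complex, 'x, 'm) module_scheme \<Rightarrow> ('a \<Rightarrow> 'x \<Rightarrow> 'x) \<Rightarrow>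
      (complex, 'y, 'n) module_scheme \<Rightarrow> ('a \<Rightarrow> 'y \<Rightarrow> 'y) \<Rightarrow> bool"
  where "equivalent_reps A X \<pi> Y \<tau> \<longleftrightarrow>
    (\<exists>T. linear_between X Y T \<and> bij_betw T (carrier X) (carrier Y) \<and>
      (\<forall>a\<in>carrier A. \<forall>x\<in>carrier X. \<tau> a (T x) = T (\<pi> a x)))"

definition bounded_op :: "'x normed \<Rightarrow> ('x \<Rightarrow> 'x) \<Rightarrow> bool"
  where "bounded_op X T \<longleftrightarrow>
    linear_between X X T \<and> (\<exists>K. \<forall>x\<in>carrier X. nrm X (T x) \<le> K * nrm X x)"

definition op_norm :: "'x normed \<Rightarrow> ('x \<Rightarrow> 'x) \<Rightarrow> real"
  where "op_norm X T = Sup {nrm X (T x) | x. x \<in> carrier X \<and> nrm X x \<le> 1}"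

definition continuous_rep :: "'a normed \<Rightarrow> 'x normed \<Rightarrow> ('a \<Rightarrow> 'x \<Rightarrow> 'x) \<Rightarrow> bool"
  where "continuous_rep A X \<pi> \<longleftrightarrow>
    normed_space X \<and> representation A X \<pi> \<and> (\<forall>a\<in>carrier A. bounded_op X (\<pi> a)) \<and>
    (\<exists>C. \<forall>a\<in>carrier A. op_norm X (\<pi> a) \<le> C * nrm A a)"


lemma strictly_irreducible_cyclic:
  assumes A: "normed_algebra A" and irr: "strictly_irreducible A X \<pi>"
  obtains z where "z \<in> carrier X" "(\<lambda>a. \<pi> a z) ` carrier A = carrier X"
proof -
  interpret A: normed_algebra A by (rule A)
  have rep: "representation A X \<pi>"
    and ker: "rep_kernel A X \<pi> \<noteq> carrier A"
    and inv: "\<And>E. submodule E complex_field X \<Longrightarrow> (\<forall>a\<in>carrier A. \<pi> a ` E \<subseteq> E)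
      \<Longrightarrow> E = {\<zero>\<^bsub>X\<^esub>} \<or> E = carrier X"
    using irr unfolding strictly_irreducible_def by blast+
  interpret X: module complex_field X
    using rep by (simp add: representation_def)
  have cl: "\<pi> a x \<in> carrier X" if "a \<in> carrier A" "x \<in> carrier X" for a x
    using rep that unfolding representation_def linear_between_def by blast
  obtain b z where bz: "b \<in> carrier A" "z \<in> carrier X" "\<pi> b z \<noteq> \<zero>\<^bsub>X\<^esub>"
    using ker unfolding rep_kernel_def by blast
  let ?E = "(\<lambda>a. \<pi> a z) ` carrier A"
  have add: "\<pi> (a \<oplus>\<^bsub>A\<^esub> c) z = \<pi> a z \<oplus>\<^bsub>X\<^esub> \<pi> c z" and mult: "\<pi> (a \<otimes>\<^bsub>A\<^esub> c) z = \<pi> a (\<pi> c z)"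
    if "a \<in> carrier A" "c \<in> carrier A" for a c
    using rep that bz unfolding representation_def by blast+
  have smult: "\<pi> (s \<odot>\<^bsub>A\<^esub> a) z = s \<odot>\<^bsub>X\<^esub> \<pi> a z" if "a \<in> carrier A" for s a
    using rep that bz unfolding representation_def by blast
  have scl: "s \<odot>\<^bsub>A\<^esub> a \<in> carrier A" if "a \<in> carrier A" for s a
    using A.smult_closed[of s a] that by (simp add: complex_field_def)
  have zero: "\<pi> \<zero>\<^bsub>A\<^esub> z = \<zero>\<^bsub>X\<^esub>"
    using add[of "\<zero>\<^bsub>A\<^esub>" "\<zero>\<^bsub>A\<^esub>"] cl[of "\<zero>\<^bsub>A\<^esub>" z] bz by (metis A.M.zero_closed A.M.l_zero X.M.add.l_cancel_one')
  have neg: "\<ominus>\<^bsub>X\<^esub> \<pi> a z = \<pi> (\<ominus>\<^bsub>A\<^esub> a) z" if "a \<in> carrier A" for a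
    using add[of "\<ominus>\<^bsub>A\<^esub> a" a] that cl bz zero
    by (intro X.M.minus_equality) (simp_all add: A.M.l_neg)
  have "submodule ?E complex_field X"
  proof (rule X.submoduleI)
    show "?E \<subseteq> carrier X"
      using cl bz by auto
    show "\<zero>\<^bsub>X\<^esub> \<in> ?E"
      using zero A.M.zero_closed by (metis image_eqI)
    show "\<ominus>\<^bsub>X\<^esub> x \<in> ?E" if "x \<in> ?E" for x
      using that neg by auto
    show "x \<oplus>\<^bsub>X\<^esub> y \<in> ?E" if xy: "x \<in> ?E" "y \<in> ?E" for x y
    proof -
      obtain a c where "a \<in> carrier A" "c \<in> carrier A" "x = \<pi> a z" "y = \<pi> c z"
        using xy by blast
      then show ?thesis
        using add A.M.add.m_closed by (metis image_eqI)
    qed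
    show "s \<odot>\<^bsub>X\<^esub> x \<in> ?E" if x: "x \<in> ?E" for s x
    proof -
      obtain a where "a \<in> carrier A" "x = \<pi> a z"
        using x by blast
      then show ?thesis
        using smult scl by (metis image_eqI)
    qed
  qed
  moreover have "\<pi> a ` ?E \<subseteq> ?E" if a: "a \<in> carrier A" for a
  proof
    fix x assume "x \<in> \<pi> a ` ?E"
    then obtain c where "c \<in> carrier A" "x = \<pi> a (\<pi> c z)"
      by blast
    then show "x \<in> ?E"
      using mult a A.mult_closed by (metis image_eqI)
  qed
  ultimately have "?E = carrier X"
    using inv[of ?E] bz by blast
  with bz that show thesis
    by blast
qed

lemma transported_rep:
  fixes X :: "(complex, 'x, 'm) module_scheme" and Y :: "(complex, 'y, 'n) module_scheme"
    and f :: "'x \<Rightarrow> 'y"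
  assumes rep: "representation A X \<pi>"
    and lin: "linear_between X Y f" and bij: "bij_betw f (carrier X) (carrier Y)"
    and zero: "f \<zero>\<^bsub>X\<^esub> = \<zero>\<^bsub>Y\<^esub>"
  defines "\<tau> \<equiv> \<lambda>a y. f (\<pi> a (inv_into (carrier X) f y))"
  shows "representation A Y \<tau>" "equivalent_reps A X \<pi> Y \<tau>"
    "rep_kernel A Y \<tau> = rep_kernel A X \<pi>"
    "strictly_irreducible A X \<pi> \<Longrightarrow> strictly_irreducible A Y \<tau>"
proof -
  interpret X: module complex_field X
    using rep by (simp add: representation_def)
  have inj: "inj_on f (carrier X)" and im: "carrier Y = f ` carrier X"
    using bij by (auto simp: bij_betw_def)
  have fcl: "f x \<in> carrier Y" if "x \<in> carrier X" for x
    using im that by blast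
  have fadd: "f x \<oplus>\<^bsub>Y\<^esub> f y = f (x \<oplus>\<^bsub>X\<^esub> y)" if "x \<in> carrier X" "y \<in> carrier X" for x y
    using lin that unfolding linear_between_def by simp
  have fsm: "c \<odot>\<^bsub>Y\<^esub> f x = f (c \<odot>\<^bsub>X\<^esub> x)" if "x \<in> carrier X" for c x
    using lin that unfolding linear_between_def by simp
  have scl: "c \<odot>\<^bsub>X\<^esub> x \<in> carrier X" if "x \<in> carrier X" for c x
    using X.smult_closed[of c x] that by (simp add: complex_field_def)
  have piadd: "\<pi> a (x \<oplus>\<^bsub>X\<^esub> y) = \<pi> a x \<oplus>\<^bsub>X\<^esub> \<pi> a y"
    if "a \<in> carrier A" "x \<in> carrier X" "y \<in> carrier X" for a x y
    using rep that by (simp add: representation_def linear_between_def)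
  have pism: "\<pi> a (c \<odot>\<^bsub>X\<^esub> x) = c \<odot>\<^bsub>X\<^esub> \<pi> a x" and picl: "\<pi> a x \<in> carrier X"
    if "a \<in> carrier A" "x \<in> carrier X" for a c x
    using rep that by (simp_all add: representation_def linear_between_def image_subset_iff)
  have piA: "\<pi> (a \<oplus>\<^bsub>A\<^esub> b) x = \<pi> a x \<oplus>\<^bsub>X\<^esub> \<pi> b x" "\<pi> (a \<otimes>\<^bsub>A\<^esub> b) x = \<pi> a (\<pi> b x)"
    "\<pi> (c \<odot>\<^bsub>A\<^esub> a) x = c \<odot>\<^bsub>X\<^esub> \<pi> a x"
    if "a \<in> carrier A" "b \<in> carrier A" "x \<in> carrier X" for a b c x
    using rep that by (simp_all add: representation_def)
  have tau: "\<tau> a (f x) = f (\<pi> a x)" if "x \<in> carrier X" for a x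
    using inj that by (simp add: \<tau>_def)
  have modY: "module complex_field Y"
  proof (rule moduleI)
    show "cring complex_field"
      by (rule cring_complex_field)
    show "abelian_group Y"
    proof (rule abelian_groupI)
      show "\<zero>\<^bsub>Y\<^esub> \<in> carrier Y"
        using fcl[of "\<zero>\<^bsub>X\<^esub>"] zero by simp
      show "\<exists>y\<in>carrier Y. y \<oplus>\<^bsub>Y\<^esub> x = \<zero>\<^bsub>Y\<^esub>" if x: "x \<in> carrier Y" for x
      proof -
        obtain u where u: "u \<in> carrier X" "x = f u"
          using x im by blast
        have "f (\<ominus>\<^bsub>X\<^esub> u) \<oplus>\<^bsub>Y\<^esub> f u = f (\<ominus>\<^bsub>X\<^esub> u \<oplus>\<^bsub>X\<^esub> u)"
          by (rule fadd) (simp_all add: u(1))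
        also have "\<dots> = \<zero>\<^bsub>Y\<^esub>"
          unfolding X.M.l_neg[OF u(1)] by (rule zero)
        finally show ?thesis
          using u fcl[OF X.M.a_inv_closed[OF u(1)]] by blast
      qed
      show "\<zero>\<^bsub>Y\<^esub> \<oplus>\<^bsub>Y\<^esub> x = x" if x: "x \<in> carrier Y" for x
      proof -
        obtain u where u: "u \<in> carrier X" "x = f u"
          using x im by blast
        then show ?thesis
          using fadd[of "\<zero>\<^bsub>X\<^esub>" u] zero by simp
      qed
    next
      fix x y z assume "x \<in> carrier Y" "y \<in> carrier Y" "z \<in> carrier Y"
      then show "(x \<oplus>\<^bsub>Y\<^esub> y) \<oplus>\<^bsub>Y\<^esub> z = x \<oplus>\<^bsub>Y\<^esub> (y \<oplus>\<^bsub>Y\<^esub> z)"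
        by (auto simp: im fadd X.M.a_assoc)
    next
      fix x y assume xy: "x \<in> carrier Y" "y \<in> carrier Y"
      then show "x \<oplus>\<^bsub>Y\<^esub> y \<in> carrier Y"
        by (auto simp: im fadd)
      obtain u v where "u \<in> carrier X" "x = f u" "v \<in> carrier X" "y = f v"
        using xy im by blast
      then show "x \<oplus>\<^bsub>Y\<^esub> y = y \<oplus>\<^bsub>Y\<^esub> x"
        by (simp add: fadd X.M.a_comm[of u v])
    qed
  next
    fix a x y assume "x \<in> carrier Y" "y \<in> carrier Y"
    then obtain u v where uv: "u \<in> carrier X" "x = f u" "v \<in> carrier X" "y = f v"
      using im by blast
    have "a \<odot>\<^bsub>X\<^esub> (u \<oplus>\<^bsub>X\<^esub> v) = a \<odot>\<^bsub>X\<^esub> u \<oplus>\<^bsub>X\<^esub> a \<odot>\<^bsub>X\<^esub> v"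
      using uv by (intro X.smult_r_distr) (simp_all add: complex_field_def)
    then show "a \<odot>\<^bsub>Y\<^esub> (x \<oplus>\<^bsub>Y\<^esub> y) = a \<odot>\<^bsub>Y\<^esub> x \<oplus>\<^bsub>Y\<^esub> a \<odot>\<^bsub>Y\<^esub> y"
      by (simp add: uv fadd fsm scl)
  next
    fix a b x assume "x \<in> carrier Y"
    then obtain u where u: "u \<in> carrier X" "x = f u"
      using im by blast
    have C: "s \<in> carrier complex_field" for s
      by (simp add: complex_field_def)
    show "a \<odot>\<^bsub>Y\<^esub> x \<in> carrier Y"
      using u by (simp add: fsm fcl scl)
    show "(a \<oplus>\<^bsub>complex_field\<^esub> b) \<odot>\<^bsub>Y\<^esub> x = a \<odot>\<^bsub>Y\<^esub> x \<oplus>\<^bsub>Y\<^esub> b \<odot>\<^bsub>Y\<^esub> x"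
      using u X.smult_l_distr[OF C C u(1), of a b] by (simp add: fadd fsm scl)
    show "(a \<otimes>\<^bsub>complex_field\<^esub> b) \<odot>\<^bsub>Y\<^esub> x = a \<odot>\<^bsub>Y\<^esub> (b \<odot>\<^bsub>Y\<^esub> x)"
      using u X.smult_assoc1[OF C C u(1), of a b] by (simp add: fsm scl)
    show "\<one>\<^bsub>complex_field\<^esub> \<odot>\<^bsub>Y\<^esub> x = x"
      using u X.smult_one[OF u(1)] by (simp add: fsm)
  qed
  then interpret Y: module complex_field Y .
  show repY: "representation A Y \<tau>"
    unfolding representation_def linear_between_def
    using modY by (auto simp: im fadd fsm scl tau picl piadd pism piA)
  show "equivalent_reps A X \<pi> Y \<tau>"
    unfolding equivalent_reps_def using lin bij tau by blast
  show ker: "rep_kernel A Y \<tau> = rep_kernel A X \<pi>"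
    unfolding rep_kernel_def using inj zero
    by (auto simp: im tau picl) (metis X.M.zero_closed inj_on_eq_iff picl)
  assume irr: "strictly_irreducible A X \<pi>"
  show "strictly_irreducible A Y \<tau>"
    unfolding strictly_irreducible_def
  proof (intro conjI allI impI)
    show "rep_kernel A Y \<tau> \<noteq> carrier A"
      using irr ker by (simp add: strictly_irreducible_def)
    fix E assume E: "submodule E complex_field Y \<and> (\<forall>a\<in>carrier A. \<tau> a ` E \<subseteq> E)"
    note sub = Y.submoduleE[OF conjunct1[OF E]]
    let ?F = "{x \<in> carrier X. f x \<in> E}"
    have Eimg: "E = f ` ?F"
      using sub(1) im by auto
    have zE: "\<zero>\<^bsub>Y\<^esub> \<in> E"
      using conjunct1[OF E] by (simp add: submodule_def subgroup_def)
    have fneg: "f (\<ominus>\<^bsub>X\<^esub> x) = \<ominus>\<^bsub>Y\<^esub> f x" if "x \<in> carrier X" for x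
      using that fadd[of "\<ominus>\<^bsub>X\<^esub> x" x] zero fcl
      by (metis X.M.a_inv_closed X.M.l_neg Y.M.minus_equality)
    have "submodule ?F complex_field X"
      by (rule X.submoduleI)
        (use sub zE zero in \<open>auto simp: fneg fadd[symmetric] fsm[symmetric] scl complex_field_def\<close>)
    moreover have "\<forall>a\<in>carrier A. \<pi> a ` ?F \<subseteq> ?F"
    proof (intro ballI subsetI)
      fix a x assume a: "a \<in> carrier A" and "x \<in> \<pi> a ` ?F"
      then obtain u where u: "u \<in> carrier X" "f u \<in> E" "x = \<pi> a u"
        by blast
      then have "\<tau> a (f u) \<in> E"
        using E a by blast
      then show "x \<in> ?F"
        using u a by (simp add: tau picl)
    qed
    ultimately have "?F = {\<zero>\<^bsub>X\<^esub>} \<or> ?F = carrier X"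
      using irr unfolding strictly_irreducible_def by blast
    then show "E = {\<zero>\<^bsub>Y\<^esub>} \<or> E = carrier Y"
    proof
      assume "?F = {\<zero>\<^bsub>X\<^esub>}"
      then have "E = f ` {\<zero>\<^bsub>X\<^esub>}"
        using Eimg by simp
      then show ?thesis
        using zero by simp
    next
      assume "?F = carrier X"
      then show ?thesis
        using Eimg im by simp
    qed
  qed (rule repY)
qed

lemma strictly_irreducible_embedding:
  fixes A :: "'a normed" and X :: "(complex, 'x, 'm) module_scheme"
  assumes "normed_algebra A" "strictly_irreducible A X \<pi>"
  obtains f :: "'x \<Rightarrow> 'a set" where "inj_on f (carrier X)"
proof -
  obtain z where z: "z \<in> carrier X" "(\<lambda>a. \<pi> a z) ` carrier A = carrier X"
    by (rule strictly_irreducible_cyclic[OF assms])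
  have "inj_on (\<lambda>x. {a \<in> carrier A. \<pi> a z = x}) (carrier X)"
  proof (rule inj_onI)
    fix x y assume "x \<in> carrier X" and eq: "{a \<in> carrier A. \<pi> a z = x} = {a \<in> carrier A. \<pi> a z = y}"
    then have "x \<in> (\<lambda>a. \<pi> a z) ` carrier A"
      by (simp add: z(2))
    then obtain a where a: "a \<in> {a \<in> carrier A. \<pi> a z = x}"
      by auto
    moreover have "a \<in> {a \<in> carrier A. \<pi> a z = y}"
      using a by (simp only: eq)
    ultimately show "x = y"
      by simp
  qed
  then show thesis
    by (rule that)
qed

definition transport :: "('x \<Rightarrow> 'y) \<Rightarrow> (complex, 'x, 'm) module_scheme \<Rightarrow> (complex, 'y) module"
  where "transport f X = (let g = inv_into (carrier X) f in
    \<lparr>carrier = f ` carrier X, mult = undefined, one = undefined, zero = f \<zero>\<^bsub>X\<^esub>,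
     add = (\<lambda>x y. f (g x \<oplus>\<^bsub>X\<^esub> g y)), smult = (\<lambda>c x. f (c \<odot>\<^bsub>X\<^esub> g x))\<rparr>)"

lemma transport_props:
  assumes "inj_on f (carrier X)"
  shows "linear_between X (transport f X) f" "bij_betw f (carrier X) (carrier (transport f X))"
    "f \<zero>\<^bsub>X\<^esub> = \<zero>\<^bsub>transport f X\<^esub>"
  using assms by (auto simp: transport_def linear_between_def bij_betw_def Let_def)

lemma strictly_irreducible_universe:
  fixes A :: "'a normed" and X :: "(complex, 'x, 'm) module_scheme"
  assumes "normed_algebra A" "strictly_irreducible A X \<pi>"
  obtains Y :: "(complex, 'a set) module" and \<tau>
  where "strictly_irreducible A Y \<tau>" "equivalent_reps A X \<pi> Y \<tau>"
proof -
  obtain f :: "'x \<Rightarrow> 'a set" where f: "inj_on f (carrier X)"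
    by (rule strictly_irreducible_embedding[OF assms])
  have "representation A X \<pi>"
    using assms by (simp add: strictly_irreducible_def)
  note tr = transported_rep[OF this transport_props[OF f]]
  show thesis
    by (rule that[OF tr(4)[OF assms(2)] tr(2)])
qed

lemma continuous_rep_universe:
  fixes A :: "'a normed" and X :: "'x normed"
  assumes A: "normed_algebra A" and irr: "strictly_irreducible A X \<pi>"
    and cont: "continuous_rep A X \<pi>"
  obtains Y :: "'a set normed" and \<tau>
  where "strictly_irreducible A Y \<tau>" "continuous_rep A Y \<tau>" "equivalent_reps A X \<pi> Y \<tau>"
    "rep_kernel A Y \<tau> = rep_kernel A X \<pi>" "banach_space X \<Longrightarrow> banach_space Y"
proof -
  obtain f :: "'x \<Rightarrow> 'a set" where f: "inj_on f (carrier X)"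
    by (rule strictly_irreducible_embedding[OF A irr])
  define g where "g = inv_into (carrier X) f"
  define T where "T = transport f X"
  define Y :: "'a set normed" where "Y = module.extend T \<lparr>nrm = \<lambda>y. nrm X (g y)\<rparr>"
  define \<tau> where "\<tau> = (\<lambda>a y. f (\<pi> a (g y)))"
  have Y: "carrier Y = carrier T" "add Y = add T" "smult Y = smult T" "zero Y = zero T"
    and nrmY: "nrm Y y = nrm X (g y)" for y
    by (simp_all add: Y_def module.defs)
  have gf: "g (f x) = x" if "x \<in> carrier X" for x
    using f that by (simp add: g_def)
  have lin: "linear_between X Y f" and bij: "bij_betw f (carrier X) (carrier Y)"
    and zero: "f \<zero>\<^bsub>X\<^esub> = \<zero>\<^bsub>Y\<^esub>"
    using transport_props[OF f] by (simp_all add: linear_between_def Y T_def)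
  have im: "carrier Y = f ` carrier X"
    using bij by (simp add: bij_betw_def)
  have rep: "representation A X \<pi>" and X: "normed_space X"
    using cont by (simp_all add: continuous_rep_def)
  note tr = transported_rep[OF rep lin bij zero, folded g_def, folded \<tau>_def]
  interpret X: normed_space X by (rule X)
  interpret Y: module complex_field Y
    using tr(1) by (simp add: representation_def)
  have fadd: "f x \<oplus>\<^bsub>Y\<^esub> f y = f (x \<oplus>\<^bsub>X\<^esub> y)" if "x \<in> carrier X" "y \<in> carrier X" for x y
    using lin that unfolding linear_between_def by simp
  have fsm: "c \<odot>\<^bsub>Y\<^esub> f x = f (c \<odot>\<^bsub>X\<^esub> x)" if "x \<in> carrier X" for c x
    using lin that unfolding linear_between_def by simp
  have scl: "c \<odot>\<^bsub>X\<^esub> x \<in> carrier X" if "x \<in> carrier X" for c x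
    using X.smult_closed[of c x] that by (simp add: complex_field_def)
  have nY: "normed_space Y"
  proof
    fix x c assume "x \<in> carrier Y"
    then obtain u where u: "u \<in> carrier X" "x = f u"
      using im by blast
    show "nrm Y x = 0 \<longleftrightarrow> x = \<zero>\<^bsub>Y\<^esub>"
      using u f by (simp add: nrmY gf X.nrm_eq_0_iff zero[symmetric] inj_on_eq_iff)
    show "nrm Y (c \<odot>\<^bsub>Y\<^esub> x) = cmod c * nrm Y x"
      using u by (simp add: nrmY gf fsm scl X.nrm_smult)
  next
    fix x y assume "x \<in> carrier Y" "y \<in> carrier Y"
    then show "nrm Y (x \<oplus>\<^bsub>Y\<^esub> y) \<le> nrm Y x + nrm Y y"
      by (auto simp: im nrmY gf fadd X.nrm_add_le)
  qed
  interpret Y: normed_space Y by (rule nY)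
  have picl: "\<pi> a x \<in> carrier X" if "a \<in> carrier A" "x \<in> carrier X" for a x
    using rep that unfolding representation_def linear_between_def by blast
  have tau: "\<tau> a (f x) = f (\<pi> a x)" if "x \<in> carrier X" for a x
    using that by (simp add: \<tau>_def gf)
  have "op_norm Y (\<tau> a) = op_norm X (\<pi> a)" if "a \<in> carrier A" for a
  proof -
    have n: "nrm Y (\<tau> a (f x)) = nrm X (\<pi> a x)" "nrm Y (f x) = nrm X x" if "x \<in> carrier X" for x
      using that \<open>a \<in> carrier A\<close> by (simp_all add: nrmY gf tau picl)
    have ball: "{y \<in> carrier Y. nrm Y y \<le> 1} = f ` {x \<in> carrier X. nrm X x \<le> 1}"
      unfolding im by (auto simp: n)
    have "{nrm Y (\<tau> a y) | y. y \<in> carrier Y \<and> nrm Y y \<le> 1} =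
      (\<lambda>y. nrm Y (\<tau> a y)) ` {y \<in> carrier Y. nrm Y y \<le> 1}"
      by (rule setcompr_eq_image)
    also have "\<dots> = (\<lambda>x. nrm X (\<pi> a x)) ` {x \<in> carrier X. nrm X x \<le> 1}"
      unfolding ball image_image by (intro image_cong) (simp_all add: n)
    also have "\<dots> = {nrm X (\<pi> a x) | x. x \<in> carrier X \<and> nrm X x \<le> 1}"
      by (rule setcompr_eq_image[symmetric])
    finally have "{nrm Y (\<tau> a y) | y. y \<in> carrier Y \<and> nrm Y y \<le> 1} =
      {nrm X (\<pi> a x) | x. x \<in> carrier X \<and> nrm X x \<le> 1}" .
    then show ?thesis
      by (simp add: op_norm_def)
  qed
  moreover have "bounded_op Y (\<tau> a)" if a: "a \<in> carrier A" for a
  proof -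
    have "bounded_op X (\<pi> a)"
      using cont a by (simp add: continuous_rep_def)
    then obtain K where "\<And>x. x \<in> carrier X \<Longrightarrow> nrm X (\<pi> a x) \<le> K * nrm X x"
      unfolding bounded_op_def by auto
    then have "\<forall>y\<in>carrier Y. nrm Y (\<tau> a y) \<le> K * nrm Y y"
      using a by (auto simp: im nrmY gf tau picl)
    moreover have "linear_between Y Y (\<tau> a)"
      using tr(1) a by (simp add: representation_def)
    ultimately show ?thesis
      by (auto simp: bounded_op_def)
  qed
  ultimately have contY: "continuous_rep A Y \<tau>"
    using cont nY tr(1) by (simp add: continuous_rep_def)
  have "banach_space Y" if "banach_space X"
  proof -
    interpret dX: Metric_space "carrier X" "norm_dist X" by (rule X.Metric_space_norm_dist)
    interpret dY: Metric_space "carrier Y" "norm_dist Y" by (rule Y.Metric_space_norm_dist)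
    have fneg: "f (\<ominus>\<^bsub>X\<^esub> x) = \<ominus>\<^bsub>Y\<^esub> f x" if "x \<in> carrier X" for x
      using that fadd[of "\<ominus>\<^bsub>X\<^esub> x" x] zero im
      by (metis X.M.a_inv_closed X.M.l_neg Y.M.minus_equality image_eqI)
    have dist: "norm_dist Y (f x) (f y) = norm_dist X x y"
      if "x \<in> carrier X" "y \<in> carrier X" for x y
      using that im by (simp add: norm_dist_def a_minus_def fneg[symmetric] fadd nrmY gf)
    have gX: "g y \<in> carrier X" "f (g y) = y" if "y \<in> carrier Y" for y
      using that im gf by auto
    have "dX.mcomplete"
      using \<open>banach_space X\<close> by (simp add: banach_space_def norm_metric_def)
    have "dY.mcomplete"
      unfolding dY.mcomplete_def
    proof (intro allI impI)
      fix s assume s: "dY.MCauchy s"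
      then have sY: "s n \<in> carrier Y" for n
        by (auto simp: dY.MCauchy_def)
      have d: "norm_dist X (g (s m)) (g (s n)) = norm_dist Y (s m) (s n)" for m n
        using dist[of "g (s m)" "g (s n)"] gX sY by simp
      have "dX.MCauchy (g \<circ> s)"
        using s gX sY by (auto simp: dX.MCauchy_def dY.MCauchy_def d)
      then obtain x where "limitin dX.mtopology (g \<circ> s) x sequentially"
        using \<open>dX.mcomplete\<close> unfolding dX.mcomplete_def by blast
      then have x: "x \<in> carrier X"
        and lim: "\<And>e. e > 0 \<Longrightarrow> \<exists>N. \<forall>n\<ge>N. norm_dist X (g (s n)) x < e"
        by (auto simp: dX.limit_metric_sequentially) meson
      have "norm_dist Y (s n) (f x) = norm_dist X (g (s n)) x" for n
        using dist[of "g (s n)" x] gX sY x by simp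
      then have "limitin dY.mtopology s (f x) sequentially"
        using lim sY imageI[OF x, of f] by (simp add: dY.limit_metric_sequentially im[symmetric])
      then show "\<exists>y. limitin dY.mtopology s y sequentially" ..
    qed
    then show ?thesis
      using nY by (simp add: banach_space_def norm_metric_def)
  qed
  then show thesis
    by (rule that[OF tr(4)[OF irr] contY tr(2) tr(3)])
qed


subsection \<open>The class of \<open>Q\<^sub>b\<close>-algebras and the two radicals\<close>

text \<open>
  For an algebra with elements in \<open>'a\<close>, representation spaces range over spaces with elements in
  \<open>'a set\<close>. This is no restriction: a strictly irreducible representation space is, up to
  isomorphism, a quotient of the algebra, whose elements are cosets. See the lemmas
  \<open>strictly_irreducible_universe\<close> and \<open>continuous_rep_universe\<close>.
\<close>

definition Qb_algebras :: "'a normed set"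
  where "Qb_algebras = {A. normed_algebra A \<and>
    (\<forall>(X :: (complex, 'a set) module) \<pi>. strictly_irreducible A X \<pi> \<longrightarrow>
      (\<exists>(Y :: 'a set normed) \<tau>. banach_space Y \<and> continuous_rep A Y \<tau> \<and>
        strictly_irreducible A Y \<tau> \<and> equivalent_reps A X \<pi> Y \<tau>))}"

text \<open>The radicals are subsets of the unitization, in the encoding by pairs.\<close>

definition rad_b :: "'a normed \<Rightarrow> ('a \<times> complex) set"
  where "rad_b A = carrier (unitization A) \<inter>
    \<Inter> {rep_kernel (unitization A) X \<pi> | (X :: ('a \<times> complex) set normed) \<pi>.
      banach_space X \<and> continuous_rep (unitization A) X \<pi> \<and>
      strictly_irreducible (unitization A) X \<pi>}"

definition rad_n :: "'a normed \<Rightarrow> ('a \<times> complex) set"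
  where "rad_n A = carrier (unitization A) \<inter>
    \<Inter> {rep_kernel (unitization A) X \<pi> | (X :: ('a \<times> complex) set normed) \<pi>.
      continuous_rep (unitization A) X \<pi> \<and> strictly_irreducible (unitization A) X \<pi>}"

end

theory Submission
  imports Defs "HOL-Algebra.AbelCoset"
begin

text \<open>
  Let \<open>x\<close> be an element of the unitization of an algebra \<open>A\<close> at distance less than 1 from the unit.
  If \<open>x\<close> has no left inverse, a maximal left ideal containing \<open>x\<close> yields an irreducible
  representation in which \<open>x\<close> kills a nonzero vector. Write \<open>x = (1 + s)1 + a\<close> with \<open>a\<close> in \<open>A\<close>. On that
  vector \<open>a\<close> acts as the scalar \<open>- (1 + s)\<close>, which is larger than \<open>\<parallel>a\<parallel>\<close> in absolute value. In a
  continuous representation this cannot happen, because there \<open>\<bar>c\<bar>\<^sup>n \<le> C \<parallel>a\<parallel>\<^sup>n\<close> for every eigenvalue \<open>c\<close> of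
  \<open>a\<close> (\<open>continuous_rep_eigenvalue_bound\<close>). So in a \<open>Q\<^sub>b\<close>-algebra every such \<open>x\<close> has a left inverse,
  and then it is invertible, because the idempotent \<open>p = 1 - xy\<close> satisfies \<open>\<parallel>p\<parallel> \<le> \<parallel>p\<parallel> \<parallel>x - 1\<parallel>\<close>
  (\<open>left_inverse_near_unit_is_inverse\<close>). Hence the invertible elements form an open set
  (\<open>Qb_algebra_is_Q_algebra\<close>).

  Both strictness claims are witnessed by the algebra of all finite complex matrices with the sum
  of the absolute values of the entries as norm. It is a Q-algebra, since the Neumann series of a
  finite matrix of norm below 1 converges entrywise to a finite matrix
  (\<open>finite_matrices_Q_algebra\<close>). It acts irreducibly and
  continuously on the finitely supported columns, which form a normed space of countably infinite
  dimension. No irreducible representation on a Banach space looks like that. If the matrix unit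
  \<open>e\<close> at the position \<open>(0, 0)\<close> fixed a vector \<open>x\<^sub>0 \<noteq> 0\<close>, the space would consist of finite combinations
  of the images of \<open>x\<^sub>0\<close> under the matrix units of the first column, while completeness provides
  infinite sums (\<open>banach_rep_kills_e\<close>). Consequently \<open>e\<close> lies in \<open>rad_b\<close> but not in \<open>rad_n\<close>, and the
  representation on columns is not equivalent to one on a Banach space.
\<close>

section \<open>Linear algebra over explicit carriers\<close>

lemma carrier_complex_field [simp]: "c \<in> carrier complex_field"
  by (simp add: complex_field_def)

lemma complex_field_ops [simp]:
  "\<one>\<^bsub>complex_field\<^esub> = 1" "\<zero>\<^bsub>complex_field\<^esub> = 0"
  "x \<oplus>\<^bsub>complex_field\<^esub> y = x + y" "x \<otimes>\<^bsub>complex_field\<^esub> y = x * y"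
  by (simp_all add: complex_field_def)

lemma complex_field_minus [simp]: "\<ominus>\<^bsub>complex_field\<^esub> x = - x"
proof -
  interpret cring complex_field
    by (rule cring_complex_field)
  show ?thesis
    by (rule minus_equality) simp_all
qed

locale complex_vs = module complex_field X for X :: "(complex, 'x, 'm) module_scheme" (structure)
begin

lemma smult_cl [simp, intro]: "x \<in> carrier X \<Longrightarrow> c \<odot> x \<in> carrier X"
  using smult_closed[of c x] by simp

lemma smult_distribs:
  "x \<in> carrier X \<Longrightarrow> (s + t) \<odot> x = s \<odot> x \<oplus> t \<odot> x"
  "\<lbrakk>x \<in> carrier X; y \<in> carrier X\<rbrakk> \<Longrightarrow> s \<odot> (x \<oplus> y) = s \<odot> x \<oplus> s \<odot> y"
  using smult_l_distr[of s t x] smult_r_distr[of s x y] by simp_all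

lemma smult_scalars [simp]:
  "x \<in> carrier X \<Longrightarrow> s \<odot> (t \<odot> x) = (s * t) \<odot> x"
  "x \<in> carrier X \<Longrightarrow> 1 \<odot> x = x"
  "x \<in> carrier X \<Longrightarrow> 0 \<odot> x = \<zero>"
  "s \<odot> \<zero> = \<zero>"
  using smult_assoc1[of s t x] smult_one[of x] smult_l_null[of x] smult_r_null[of s] by simp_all

lemma neg_eq_smult: "x \<in> carrier X \<Longrightarrow> \<ominus> x = (- 1) \<odot> x"
  using smult_l_minus[of 1 x] by simp

lemma smult_eq_zero_iff:
  assumes "x \<in> carrier X"
  shows "c \<odot> x = \<zero> \<longleftrightarrow> c = 0 \<or> x = \<zero>"
proof (cases "c = 0")
  case False
  then have "x = inverse c \<odot> (c \<odot> x)"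
    using assms by simp
  then show ?thesis
    using assms smult_scalars(4)[of "inverse c"] by (metis smult_scalars(3,4))
qed (use assms in simp)

lemma minus_eq_zero_iff:
  "\<lbrakk>x \<in> carrier X; y \<in> carrier X\<rbrakk> \<Longrightarrow> x \<ominus> y = \<zero> \<longleftrightarrow> x = y"
  by (metis a_minus_def M.a_inv_closed M.minus_equality M.minus_minus M.r_neg)

lemma minus_add_cancel: "\<lbrakk>x \<in> carrier X; y \<in> carrier X\<rbrakk> \<Longrightarrow> (x \<ominus> y) \<oplus> y = x"
  by (simp add: a_minus_def M.a_assoc M.l_neg)

lemma submodule_vsI:
  assumes "H \<subseteq> carrier X" "\<zero> \<in> H" "\<And>x y. \<lbrakk>x \<in> H; y \<in> H\<rbrakk> \<Longrightarrow> x \<oplus> y \<in> H"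
    "\<And>c x. x \<in> H \<Longrightarrow> c \<odot> x \<in> H"
  shows "submodule H complex_field X"
proof (rule submoduleI)
  show "\<ominus> x \<in> H" if "x \<in> H" for x
    using assms that by (metis neg_eq_smult subsetD)
qed (use assms in auto)

lemma submodule_vsE:
  assumes "submodule H complex_field X"
  shows "H \<subseteq> carrier X" "\<zero> \<in> H" "\<And>x y. \<lbrakk>x \<in> H; y \<in> H\<rbrakk> \<Longrightarrow> x \<oplus> y \<in> H"
    "\<And>c x. x \<in> H \<Longrightarrow> c \<odot> x \<in> H"
proof -
  show "\<zero> \<in> H"
    using assms by (simp add: submodule_def subgroup_def)
qed (use submoduleE[OF assms] in auto)

end

sublocale normed_space \<subseteq> vs: complex_vs X
  by unfold_locales

context normed_space
begin

lemma nrm_zero [simp]: "nrm X \<zero> = 0"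
  by (simp add: nrm_eq_0_iff)

lemma nrm_pos: "\<lbrakk>x \<in> carrier X; x \<noteq> \<zero>\<rbrakk> \<Longrightarrow> 0 < nrm X x"
  using nrm_nonneg[of x] nrm_eq_0_iff[of x] by simp

lemma nrm_uminus: "x \<in> carrier X \<Longrightarrow> nrm X (\<ominus> x) = nrm X x"
  by (simp add: vs.neg_eq_smult nrm_smult)

lemma Metric_space_norm_metric:
  shows "mtopology_of (norm_metric X) = Metric_space.mtopology (carrier X) (norm_dist X)"
    and "mcomplete_of (norm_metric X) = Metric_space.mcomplete (carrier X) (norm_dist X)"
proof -
  interpret d: Metric_space "carrier X" "norm_dist X"
    by (rule Metric_space_norm_dist)
  show "mtopology_of (norm_metric X) = d.mtopology" "mcomplete_of (norm_metric X) = d.mcomplete"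
    by (simp_all add: norm_metric_def)
qed

lemma normed_space_submodule:
  assumes "submodule H complex_field X"
  shows "normed_space (X\<lparr>carrier := H\<rparr>)"
proof -
  have H: "H \<subseteq> carrier X"
    using vs.submodule_vsE(1)[OF assms] .
  interpret S: module complex_field "X\<lparr>carrier := H\<rparr>"
    by (rule submodule.submodule_is_module[OF assms]) unfold_locales
  show ?thesis
    by unfold_locales (use H in \<open>auto simp: nrm_eq_0_iff nrm_add_le nrm_smult subset_iff\<close>)
qed

end

text \<open>
  The partial sums form a Cauchy sequence, since two of them from the index \<open>N\<close> on differ by at most
  a tail \<open>2 (1/2)\<^sup>N\<close> of the geometric series.
\<close>

lemma banach_space_series:
  assumes X: "banach_space X" and y: "\<And>n. y n \<in> carrier X" "\<And>n. nrm X (y n) \<le> (1/2) ^ n"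
    and s: "s 0 = \<zero>\<^bsub>X\<^esub>" "\<And>n. s (Suc n) = s n \<oplus>\<^bsub>X\<^esub> y n"
  obtains x where "x \<in> carrier X"
    "\<And>\<epsilon>. \<epsilon> > 0 \<Longrightarrow> \<exists>N. \<forall>n\<ge>N. nrm X (s n \<ominus>\<^bsub>X\<^esub> x) < \<epsilon>"
proof -
  interpret normed_space X
    using X by (simp add: banach_space_def)
  interpret d: Metric_space "carrier X" "norm_dist X"
    by (rule Metric_space_norm_dist)
  have sc [simp]: "s n \<in> carrier X" for n
    by (induction n) (simp_all add: s y)
  have step: "norm_dist X (s n) (s (Suc n)) \<le> (1/2) ^ n" for n
  proof -
    have "s (Suc n) \<ominus>\<^bsub>X\<^esub> s n = y n"
      using y(1)[of n] sc[of n] unfolding s a_minus_def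
      by (metis M.a_ac(1,2) M.a_inv_closed M.r_neg1)
    then have "norm_dist X (s (Suc n)) (s n) \<le> (1/2) ^ n"
      using y(2)[of n] by (simp add: norm_dist_def)
    then show ?thesis
      by (simp add: d.commute)
  qed
  have tail: "norm_dist X (s n) (s (n + k)) \<le> 2 * (1/2) ^ n - 2 * (1/2) ^ (n + k)" for n k
  proof (induction k)
    case (Suc k)
    have "norm_dist X (s n) (s (Suc (n + k)))
      \<le> norm_dist X (s n) (s (n + k)) + norm_dist X (s (n + k)) (s (Suc (n + k)))"
      by (rule d.triangle) simp_all
    then show ?case
      using Suc step[of "n + k"] by simp
  qed simp
  have small: "norm_dist X (s m) (s n) \<le> 2 * (1/2) ^ N" if "N \<le> m" "N \<le> n" for m n N
  proof -
    have *: "norm_dist X (s m) (s n) \<le> 2 * (1/2) ^ N" if "N \<le> m" "m \<le> n" for m n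
    proof -
      have "norm_dist X (s m) (s n) \<le> 2 * (1/2) ^ m - 2 * (1/2) ^ n"
        using tail[of m "n - m"] that by simp
      also have "\<dots> \<le> 2 * (1/2) ^ m"
        by simp
      also have "\<dots> \<le> 2 * (1/2) ^ N"
        using that by (simp add: power_decreasing)
      finally show ?thesis .
    qed
    show ?thesis
      using *[of m n] *[of n m] that by (cases "m \<le> n") (simp_all add: d.commute)
  qed
  have "d.MCauchy s"
    unfolding d.MCauchy_def
  proof (intro conjI allI impI)
    fix \<epsilon> :: real assume "\<epsilon> > 0"
    then obtain N where "(1/2) ^ N < \<epsilon> / 2"
      using real_arch_pow_inv[of "\<epsilon> / 2" "1/2"] by auto
    then show "\<exists>N. \<forall>n n'. N \<le> n \<longrightarrow> N \<le> n' \<longrightarrow> norm_dist X (s n) (s n') < \<epsilon>"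
      using small by (intro exI[of _ N]) (smt (verit) field_sum_of_halves)
  qed auto
  moreover have "d.mcomplete"
    using X by (simp add: banach_space_def Metric_space_norm_metric)
  ultimately obtain x where "limitin d.mtopology s x sequentially"
    unfolding d.mcomplete_def by blast
  then have x: "x \<in> carrier X" "\<And>\<epsilon>. \<epsilon> > 0 \<Longrightarrow> \<exists>N. \<forall>n\<ge>N. norm_dist X (s n) x < \<epsilon>"
    by (auto simp: d.limit_metric_sequentially)
  then show thesis
    using that[of x] by (simp add: norm_dist_def)
qed

section \<open>Representations\<close>

locale algebra_rep = A: normed_algebra A + X: complex_vs X
  for A :: "'a normed" and X :: "(complex, 'x, 'm) module_scheme" and \<pi> +
  assumes rep: "representation A X \<pi>"
begin

lemma act_closed [simp]: "\<lbrakk>a \<in> carrier A; x \<in> carrier X\<rbrakk> \<Longrightarrow> \<pi> a x \<in> carrier X"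
  using rep unfolding representation_def linear_between_def by blast

lemma act_linear:
  "\<lbrakk>a \<in> carrier A; x \<in> carrier X; y \<in> carrier X\<rbrakk> \<Longrightarrow> \<pi> a (x \<oplus>\<^bsub>X\<^esub> y) = \<pi> a x \<oplus>\<^bsub>X\<^esub> \<pi> a y"
  "\<lbrakk>a \<in> carrier A; x \<in> carrier X\<rbrakk> \<Longrightarrow> \<pi> a (c \<odot>\<^bsub>X\<^esub> x) = c \<odot>\<^bsub>X\<^esub> \<pi> a x"
  using rep unfolding representation_def linear_between_def by blast+

lemma act_hom:
  "\<lbrakk>a \<in> carrier A; b \<in> carrier A; x \<in> carrier X\<rbrakk> \<Longrightarrow> \<pi> (a \<oplus>\<^bsub>A\<^esub> b) x = \<pi> a x \<oplus>\<^bsub>X\<^esub> \<pi> b x"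
  "\<lbrakk>a \<in> carrier A; b \<in> carrier A; x \<in> carrier X\<rbrakk> \<Longrightarrow> \<pi> (a \<otimes>\<^bsub>A\<^esub> b) x = \<pi> a (\<pi> b x)"
  "\<lbrakk>a \<in> carrier A; x \<in> carrier X\<rbrakk> \<Longrightarrow> \<pi> (c \<odot>\<^bsub>A\<^esub> a) x = c \<odot>\<^bsub>X\<^esub> \<pi> a x"
  using rep unfolding representation_def by blast+

lemma act_zero [simp]:
  "a \<in> carrier A \<Longrightarrow> \<pi> a \<zero>\<^bsub>X\<^esub> = \<zero>\<^bsub>X\<^esub>"
  "x \<in> carrier X \<Longrightarrow> \<pi> \<zero>\<^bsub>A\<^esub> x = \<zero>\<^bsub>X\<^esub>"
  using act_linear(2)[of a "\<zero>\<^bsub>X\<^esub>" 0] act_hom(3)[of "\<zero>\<^bsub>A\<^esub>" x 0] by simp_all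

lemma act_minus:
  "\<lbrakk>a \<in> carrier A; x \<in> carrier X; y \<in> carrier X\<rbrakk> \<Longrightarrow> \<pi> a (x \<ominus>\<^bsub>X\<^esub> y) = \<pi> a x \<ominus>\<^bsub>X\<^esub> \<pi> a y"
  by (simp add: a_minus_def act_linear X.neg_eq_smult)

lemma submodule_orbit:
  assumes "x \<in> carrier X"
  shows "submodule ((\<lambda>a. \<pi> a x) ` carrier A) complex_field X"
proof (rule X.submodule_vsI)
  show "\<zero>\<^bsub>X\<^esub> \<in> (\<lambda>a. \<pi> a x) ` carrier A"
    using assms by (intro image_eqI[of _ _ "\<zero>\<^bsub>A\<^esub>"]) simp_all
next
  fix u v assume "u \<in> (\<lambda>a. \<pi> a x) ` carrier A" "v \<in> (\<lambda>a. \<pi> a x) ` carrier A"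
  then obtain a b where "a \<in> carrier A" "b \<in> carrier A" "u = \<pi> a x" "v = \<pi> b x"
    by blast
  then show "u \<oplus>\<^bsub>X\<^esub> v \<in> (\<lambda>a. \<pi> a x) ` carrier A"
    using assms by (intro image_eqI[of _ _ "a \<oplus>\<^bsub>A\<^esub> b"]) (simp_all add: act_hom)
next
  fix c u assume "u \<in> (\<lambda>a. \<pi> a x) ` carrier A"
  then obtain a where "a \<in> carrier A" "u = \<pi> a x"
    by blast
  then show "c \<odot>\<^bsub>X\<^esub> u \<in> (\<lambda>a. \<pi> a x) ` carrier A"
    using assms by (intro image_eqI[of _ _ "c \<odot>\<^bsub>A\<^esub> a"]) (simp_all add: act_hom)
qed (use assms in auto)

lemma strictly_irreducible_orbit:
  assumes irr: "strictly_irreducible A X \<pi>"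
    and x: "x \<in> carrier X" and b: "b \<in> carrier A" "\<pi> b x \<noteq> \<zero>\<^bsub>X\<^esub>"
  shows "(\<lambda>a. \<pi> a x) ` carrier A = carrier X"
proof -
  let ?E = "(\<lambda>a. \<pi> a x) ` carrier A"
  have "\<pi> a ` ?E \<subseteq> ?E" if "a \<in> carrier A" for a
    using that x by (auto simp: act_hom(2)[symmetric] A.mult_closed)
  then have "?E = {\<zero>\<^bsub>X\<^esub>} \<or> ?E = carrier X"
    using irr submodule_orbit[OF x] unfolding strictly_irreducible_def by blast
  then show ?thesis
    using b by blast
qed

lemma strictly_irreducible_if_transitive:
  assumes "x \<in> carrier X" "x \<noteq> \<zero>\<^bsub>X\<^esub>"
    and trans: "\<And>v w. \<lbrakk>v \<in> carrier X; v \<noteq> \<zero>\<^bsub>X\<^esub>; w \<in> carrier X\<rbrakk> \<Longrightarrow> \<exists>a\<in>carrier A. \<pi> a v = w"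
  shows "strictly_irreducible A X \<pi>"
  unfolding strictly_irreducible_def
proof (intro conjI allI impI)
  show "rep_kernel A X \<pi> \<noteq> carrier A"
  proof -
    obtain a where "a \<in> carrier A" "\<pi> a x = x"
      using trans[of x x] assms(1,2) by blast
    then have "a \<notin> rep_kernel A X \<pi>"
      using assms(1,2) unfolding rep_kernel_def by force
    then show ?thesis
      using \<open>a \<in> carrier A\<close> by blast
  qed
  fix E assume E: "submodule E complex_field X \<and> (\<forall>a\<in>carrier A. \<pi> a ` E \<subseteq> E)"
  note sub = X.submodule_vsE[OF conjunct1[OF E]]
  show "E = {\<zero>\<^bsub>X\<^esub>} \<or> E = carrier X"
  proof (rule disjCI)
    assume "E \<noteq> carrier X"
    then obtain w where w: "w \<in> carrier X" "w \<notin> E"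
      using sub(1) by blast
    have "v = \<zero>\<^bsub>X\<^esub>" if "v \<in> E" for v
    proof (rule ccontr)
      assume "v \<noteq> \<zero>\<^bsub>X\<^esub>"
      moreover have "v \<in> carrier X"
        using that sub(1) by blast
      ultimately obtain a where a: "a \<in> carrier A" "\<pi> a v = w"
        using trans[OF _ _ w(1)] by blast
      then have "\<pi> a ` E \<subseteq> E"
        using E by blast
      then show False
        using that w(2) a(2) by blast
    qed
    then show "E = {\<zero>\<^bsub>X\<^esub>}"
      using sub(2) by blast
  qed
qed (rule rep)

end

lemma algebra_repI: "\<lbrakk>normed_algebra A; representation A X \<pi>\<rbrakk> \<Longrightarrow> algebra_rep A X \<pi>"
  by (simp add: algebra_rep_def algebra_rep_axioms_def complex_vs_def representation_def)

lemma representation_image: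
  assumes rep: "representation A X \<pi>" and A: "normed_algebra A"
    and lin: "linear_between X Y f" and im: "f ` carrier X = carrier Y"
    and zero: "f \<zero>\<^bsub>X\<^esub> = \<zero>\<^bsub>Y\<^esub>"
    and tau: "\<And>a x. \<lbrakk>a \<in> carrier A; x \<in> carrier X\<rbrakk> \<Longrightarrow> \<tau> a (f x) = f (\<pi> a x)"
  shows "representation A Y \<tau>"
proof -
  interpret algebra_rep A X \<pi>
    using A rep by (rule algebra_repI)
  have im': "carrier Y = f ` carrier X"
    using im by simp
  have fadd: "f x \<oplus>\<^bsub>Y\<^esub> f y = f (x \<oplus>\<^bsub>X\<^esub> y)" if "x \<in> carrier X" "y \<in> carrier X" for x y
    using lin that by (simp add: linear_between_def)
  have fsm: "c \<odot>\<^bsub>Y\<^esub> f x = f (c \<odot>\<^bsub>X\<^esub> x)" if "x \<in> carrier X" for c x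
    using lin that by (simp add: linear_between_def)
  have "abelian_group Y"
  proof (rule abelian_groupI)
    show "\<zero>\<^bsub>Y\<^esub> \<in> carrier Y"
      using zero im by (metis X.M.zero_closed imageI)
    show "\<exists>y\<in>carrier Y. y \<oplus>\<^bsub>Y\<^esub> x = \<zero>\<^bsub>Y\<^esub>" if x: "x \<in> carrier Y" for x
    proof -
      obtain u where u: "u \<in> carrier X" "x = f u"
        using x im by blast
      then have "f (\<ominus>\<^bsub>X\<^esub> u) \<oplus>\<^bsub>Y\<^esub> x = \<zero>\<^bsub>Y\<^esub>"
        by (simp add: fadd X.M.l_neg zero)
      then show ?thesis
        using u im by blast
    qed
    show "x \<oplus>\<^bsub>Y\<^esub> y = y \<oplus>\<^bsub>Y\<^esub> x" if "x \<in> carrier Y" "y \<in> carrier Y" for x y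
      using that by (auto simp: im' fadd X.M.a_comm)
    show "\<zero>\<^bsub>Y\<^esub> \<oplus>\<^bsub>Y\<^esub> x = x" if "x \<in> carrier Y" for x
      using that by (auto simp: im' fadd zero[symmetric])
  qed (auto simp: im' fadd X.M.a_assoc)
  then have "module complex_field Y"
    by (intro moduleI cring_complex_field) (auto simp: im' fadd fsm X.smult_distribs)
  then show ?thesis
    unfolding representation_def linear_between_def
    by (auto simp: im' fadd fsm tau act_linear act_hom A.mult_closed)
qed

text \<open>
  The quotient of a representation space by an invariant subspace is the transport along the
  coset map: its operations are computed on chosen representatives.
\<close>

lemma quotient_representation:
  fixes X :: "(complex, 'x, 'm) module_scheme"
  assumes A: "normed_algebra A" and rep: "representation A X \<pi>"
    and N: "submodule N complex_field X" and inv: "\<forall>a\<in>carrier A. \<pi> a ` N \<subseteq> N"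
  obtains Y :: "(complex, 'x set) module" and \<tau> q
  where "representation A Y \<tau>" "linear_between X Y q" "q ` carrier X = carrier Y"
    "\<And>x. x \<in> carrier X \<Longrightarrow> q x = \<zero>\<^bsub>Y\<^esub> \<longleftrightarrow> x \<in> N"
    "\<And>a x. \<lbrakk>a \<in> carrier A; x \<in> carrier X\<rbrakk> \<Longrightarrow> \<tau> a (q x) = q (\<pi> a x)"
proof -
  interpret algebra_rep A X \<pi>
    using A rep by (rule algebra_repI)
  note sub = X.submodule_vsE[OF N]
  interpret N: abelian_subgroup N X
    using N by (intro abelian_subgroupI3 additive_subgroupI) (simp_all add: submodule_def X.M.abelian_group_axioms)
  define q where "q = (\<lambda>x. N +>\<^bsub>X\<^esub> x)"
  define g where "g = inv_into (carrier X) q"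
  define Y where "Y = transport q X"
  have q_eq: "q x = q y \<longleftrightarrow> x \<ominus>\<^bsub>X\<^esub> y \<in> N" if "x \<in> carrier X" "y \<in> carrier X" for x y
    using that N.a_rcos_module[of y x] N.a_rcos_self[of x] X.M.a_repr_independence[OF _ _ N.a_subgroup, of x y]
    unfolding q_def by (metis a_minus_def)
  have g: "g (q x) \<in> carrier X" "g (q x) \<ominus>\<^bsub>X\<^esub> x \<in> N" if "x \<in> carrier X" for x
  proof -
    show c: "g (q x) \<in> carrier X"
      unfolding g_def using that by (intro inv_into_into) simp
    have "q (g (q x)) = q x"
      unfolding g_def using that by (intro f_inv_into_f) simp
    then show "g (q x) \<ominus>\<^bsub>X\<^esub> x \<in> N"
      using q_eq[OF c that] by simp
  qed
  have add: "q (g (q x) \<oplus>\<^bsub>X\<^esub> g (q y)) = q (x \<oplus>\<^bsub>X\<^esub> y)"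
    if xy: "x \<in> carrier X" "y \<in> carrier X" for x y
  proof -
    have "(g (q x) \<oplus>\<^bsub>X\<^esub> g (q y)) \<ominus>\<^bsub>X\<^esub> (x \<oplus>\<^bsub>X\<^esub> y) = (g (q x) \<ominus>\<^bsub>X\<^esub> x) \<oplus>\<^bsub>X\<^esub> (g (q y) \<ominus>\<^bsub>X\<^esub> y)"
      using g xy by (simp add: a_minus_def X.M.minus_add X.M.a_ac)
    then show ?thesis
      using g xy sub(3) q_eq by simp
  qed
  have smult: "q (c \<odot>\<^bsub>X\<^esub> g (q x)) = q (c \<odot>\<^bsub>X\<^esub> x)" if x: "x \<in> carrier X" for c x
  proof -
    have "c \<odot>\<^bsub>X\<^esub> g (q x) \<ominus>\<^bsub>X\<^esub> c \<odot>\<^bsub>X\<^esub> x = c \<odot>\<^bsub>X\<^esub> (g (q x) \<ominus>\<^bsub>X\<^esub> x)"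
      using g x by (simp add: a_minus_def X.smult_distribs X.neg_eq_smult)
    then show ?thesis
      using g x sub(4) q_eq by simp
  qed
  have lin: "linear_between X Y q" and im: "q ` carrier X = carrier Y" and zero: "q \<zero>\<^bsub>X\<^esub> = \<zero>\<^bsub>Y\<^esub>"
    using add smult by (auto simp: linear_between_def Y_def transport_def Let_def g_def[symmetric])
  define \<tau> where "\<tau> = (\<lambda>a y. q (\<pi> a (g y)))"
  have tau: "\<tau> a (q x) = q (\<pi> a x)" if "a \<in> carrier A" "x \<in> carrier X" for a x
  proof -
    have "\<pi> a (g (q x)) \<ominus>\<^bsub>X\<^esub> \<pi> a x = \<pi> a (g (q x) \<ominus>\<^bsub>X\<^esub> x)"
      using g that by (simp add: act_minus)
    moreover have "\<pi> a (g (q x) \<ominus>\<^bsub>X\<^esub> x) \<in> N"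
      using g(2)[OF that(2)] that(1) inv by blast
    ultimately show ?thesis
      using g that q_eq by (simp add: \<tau>_def)
  qed
  have "representation A Y \<tau>"
    using rep A lin im zero tau by (rule representation_image)
  moreover have "q x = \<zero>\<^bsub>Y\<^esub> \<longleftrightarrow> x \<in> N" if "x \<in> carrier X" for x
    using q_eq[of x "\<zero>\<^bsub>X\<^esub>"] that zero X.neg_eq_smult[of "\<zero>\<^bsub>X\<^esub>"] by (simp add: a_minus_def)
  ultimately show thesis
    using that[of Y \<tau> q] lin im tau by blast
qed

lemma equivalent_reps_eigenvector:
  assumes A: "normed_algebra A" and X: "representation A X \<pi>" and Y: "representation A Y \<tau>"
    and equiv: "equivalent_reps A X \<pi> Y \<tau>"
    and a: "a \<in> carrier A" and z: "z \<in> carrier X" "z \<noteq> \<zero>\<^bsub>X\<^esub>" "\<pi> a z = c \<odot>\<^bsub>X\<^esub> z"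
  obtains w where "w \<in> carrier Y" "w \<noteq> \<zero>\<^bsub>Y\<^esub>" "\<tau> a w = c \<odot>\<^bsub>Y\<^esub> w"
proof -
  interpret X: algebra_rep A X \<pi>
    using A X by (rule algebra_repI)
  interpret Y: algebra_rep A Y \<tau>
    using A Y by (rule algebra_repI)
  obtain T where T: "linear_between X Y T" "bij_betw T (carrier X) (carrier Y)"
    "\<forall>a\<in>carrier A. \<forall>x\<in>carrier X. \<tau> a (T x) = T (\<pi> a x)"
    using equiv unfolding equivalent_reps_def by blast
  have cl: "T x \<in> carrier Y" if "x \<in> carrier X" for x
    using T(1) that by (auto simp: linear_between_def)
  have sm: "T (s \<odot>\<^bsub>X\<^esub> x) = s \<odot>\<^bsub>Y\<^esub> T x" if "x \<in> carrier X" for s x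
    using T(1) that by (simp add: linear_between_def)
  have "T \<zero>\<^bsub>X\<^esub> = \<zero>\<^bsub>Y\<^esub>"
    using sm[of "\<zero>\<^bsub>X\<^esub>" 0] cl[of "\<zero>\<^bsub>X\<^esub>"] by simp
  then have "T z \<noteq> \<zero>\<^bsub>Y\<^esub>"
    using T(2) z by (metis X.X.M.zero_closed bij_betw_imp_inj_on inj_on_eq_iff)
  then show thesis
    using that[of "T z"] T(3) a z cl sm by simp
qed

text \<open>
  Boundedness of \<open>\<pi> a\<close> makes the supremum that defines its operator norm one of a bounded set. As
  it ranges over the unit ball, \<open>x\<close> has to be scaled to norm 1.
\<close>

lemma continuous_rep_bound:
  assumes cont: "continuous_rep A X \<pi>" and a: "a \<in> carrier A" and x: "x \<in> carrier X"
  shows "nrm X (\<pi> a x) \<le> op_norm X (\<pi> a) * nrm X x"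
proof -
  interpret normed_space X
    using cont by (simp add: continuous_rep_def)
  have bdd: "bounded_op X (\<pi> a)" and rep: "representation A X \<pi>"
    using cont a by (simp_all add: continuous_rep_def)
  have lin: "linear_between X X (\<pi> a)"
    using bdd by (simp add: bounded_op_def)
  obtain K where K: "\<And>x. x \<in> carrier X \<Longrightarrow> nrm X (\<pi> a x) \<le> K * nrm X x"
    using bdd unfolding bounded_op_def by blast
  have sm: "\<pi> a (c \<odot>\<^bsub>X\<^esub> x) = c \<odot>\<^bsub>X\<^esub> \<pi> a x" and cl: "\<pi> a x \<in> carrier X"
    if "x \<in> carrier X" for c x
    using lin that by (auto simp: linear_between_def)
  let ?S = "{nrm X (\<pi> a x) | x. x \<in> carrier X \<and> nrm X x \<le> 1}"
  have "bdd_above ?S"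
  proof (rule bdd_aboveI[of _ "\<bar>K\<bar>"])
    fix r assume "r \<in> ?S"
    then obtain v where v: "v \<in> carrier X" "nrm X v \<le> 1" "r = nrm X (\<pi> a v)"
      by blast
    have "K * nrm X v \<le> \<bar>K\<bar> * 1"
      using v nrm_nonneg[OF v(1)] by (intro mult_mono) auto
    then show "r \<le> \<bar>K\<bar>"
      using K[OF v(1)] v(3) by simp
  qed
  show ?thesis
  proof (cases "x = \<zero>\<^bsub>X\<^esub>")
    case True
    then show ?thesis
      using K[of "\<zero>\<^bsub>X\<^esub>"] by simp
  next
    case False
    let ?c = "inverse (complex_of_real (nrm X x))"
    have pos: "nrm X x > 0"
      using x False by (rule nrm_pos)
    then have c: "cmod ?c = inverse (nrm X x)"
      by (simp add: norm_inverse)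
    have "nrm X (\<pi> a (?c \<odot>\<^bsub>X\<^esub> x)) \<in> ?S"
      using x c pos by (intro CollectI exI[of _ "?c \<odot>\<^bsub>X\<^esub> x"]) (simp add: nrm_smult)
    then have "nrm X (\<pi> a (?c \<odot>\<^bsub>X\<^esub> x)) \<le> op_norm X (\<pi> a)"
      unfolding op_norm_def by (rule cSup_upper) fact
    then show ?thesis
      using x cl pos unfolding sm[OF x] nrm_smult[OF cl[OF x]] c by (simp add: field_simps)
  qed
qed

text \<open>
  The constant of continuity disappears on passing to powers: as \<open>a\<^sup>n w = c\<^sup>n w\<close>, continuity gives
  \<open>\<bar>c\<bar>\<^sup>n \<le> C \<parallel>a\<parallel>\<^sup>n\<close> for all \<open>n \<ge> 1\<close>.
\<close>

lemma continuous_rep_eigenvalue_bound: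
  assumes A: "normed_algebra A" and cont: "continuous_rep A X \<pi>"
    and a: "a \<in> carrier A" and w: "w \<in> carrier X" "w \<noteq> \<zero>\<^bsub>X\<^esub>" "\<pi> a w = c \<odot>\<^bsub>X\<^esub> w"
  shows "cmod c \<le> nrm A a"
proof (rule ccontr)
  assume "\<not> cmod c \<le> nrm A a"
  then have less: "nrm A a < cmod c"
    by simp
  interpret A: normed_algebra A
    by (rule A)
  interpret X: normed_space X
    using cont by (simp add: continuous_rep_def)
  interpret algebra_rep A X \<pi>
    using A cont by (intro algebra_repI) (simp_all add: continuous_rep_def)
  obtain C where C: "\<And>a. a \<in> carrier A \<Longrightarrow> op_norm X (\<pi> a) \<le> C * nrm A a"
    using cont unfolding continuous_rep_def by blast
  \<comment> \<open>\<open>p n\<close> is the power with exponent \<open>n + 1\<close>, because \<open>A\<close> may have no unit.\<close>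
  define p where "p = rec_nat a (\<lambda>_ b. a \<otimes>\<^bsub>A\<^esub> b)"
  have p: "p 0 = a" "p (Suc n) = a \<otimes>\<^bsub>A\<^esub> p n" for n
    by (simp_all add: p_def)
  have pc [simp]: "p n \<in> carrier A" for n
    by (induction n) (simp_all add: p a A.mult_closed)
  have pn: "nrm A (p n) \<le> nrm A a ^ Suc n" for n
  proof (induction n)
    case (Suc n)
    have "nrm A (p (Suc n)) \<le> nrm A a * nrm A (p n)"
      unfolding p by (rule A.nrm_mult_le) (simp_all add: a)
    also have "\<dots> \<le> nrm A a * nrm A a ^ Suc n"
      by (rule mult_left_mono[OF Suc A.nrm_nonneg[OF a]])
    finally show ?case
      by simp
  qed (simp add: p)
  have pw: "\<pi> (p n) w = c ^ Suc n \<odot>\<^bsub>X\<^esub> w" for n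
    by (induction n) (simp_all add: p act_hom act_linear a w mult.commute)
  have nw: "nrm X w > 0"
    using w by (simp add: X.nrm_pos)
  have power_le: "cmod c ^ Suc n \<le> \<bar>C\<bar> * nrm A a ^ Suc n" for n
  proof -
    have "cmod c ^ Suc n * nrm X w = nrm X (\<pi> (p n) w)"
      unfolding pw using w by (simp add: X.nrm_smult norm_mult norm_power del: power_Suc)
    also have "\<dots> \<le> op_norm X (\<pi> (p n)) * nrm X w"
      by (rule continuous_rep_bound[OF cont]) (simp_all add: w)
    also have "\<dots> \<le> (\<bar>C\<bar> * nrm A a ^ Suc n) * nrm X w"
    proof (rule mult_right_mono)
      have "op_norm X (\<pi> (p n)) \<le> C * nrm A (p n)"
        by (rule C) simp
      also have "\<dots> \<le> \<bar>C\<bar> * nrm A a ^ Suc n"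
        by (intro mult_mono pn) (simp_all add: A.nrm_nonneg)
      finally show "op_norm X (\<pi> (p n)) \<le> \<bar>C\<bar> * nrm A a ^ Suc n" .
    qed (use nw in simp)
    finally show ?thesis
      using nw by simp
  qed
  define t where "t = nrm A a / cmod c"
  have c: "cmod c > 0"
    using less A.nrm_nonneg[OF a] by linarith
  have t: "0 \<le> t" "t < 1" "nrm A a = t * cmod c"
    using less c A.nrm_nonneg[OF a] by (simp_all add: t_def)
  obtain n where n: "t ^ n < 1 / (\<bar>C\<bar> + 1)"
    using real_arch_pow_inv[of "1 / (\<bar>C\<bar> + 1)" t] t(2) by (auto simp: add_nonneg_pos)
  have "1 * cmod c ^ Suc n \<le> (\<bar>C\<bar> * t ^ Suc n) * cmod c ^ Suc n"
    using power_le[of n] unfolding t(3) power_mult_distrib by (simp only: mult.assoc mult_1)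
  then have "1 \<le> \<bar>C\<bar> * t ^ Suc n"
    by (rule mult_right_le_imp_le) (use c in simp)
  also have "\<dots> \<le> \<bar>C\<bar> * t ^ n"
    using t by (intro mult_left_mono power_decreasing) auto
  also have "\<dots> \<le> \<bar>C\<bar> * (1 / (\<bar>C\<bar> + 1))"
    using n by (intro mult_left_mono) auto
  finally show False
    by (simp add: field_simps)
qed

section \<open>Left ideals\<close>

definition left_ideal :: "'a normed \<Rightarrow> 'a set \<Rightarrow> bool"
  where "left_ideal A L \<longleftrightarrow>
    submodule L complex_field A \<and> (\<forall>a\<in>carrier A. \<forall>x\<in>L. a \<otimes>\<^bsub>A\<^esub> x \<in> L)"

context normed_algebra
begin

lemma mult_zero [simp]:
  "a \<in> carrier A \<Longrightarrow> a \<otimes> \<zero> = \<zero>" "a \<in> carrier A \<Longrightarrow> \<zero> \<otimes> a = \<zero>"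
  using mult_smult[of a \<zero> 0] smult_mult[of \<zero> a 0] by (simp_all add: mult_closed)

lemma mult_minus:
  "\<lbrakk>a \<in> carrier A; b \<in> carrier A; c \<in> carrier A\<rbrakk> \<Longrightarrow> a \<otimes> (b \<ominus> c) = a \<otimes> b \<ominus> a \<otimes> c"
  "\<lbrakk>a \<in> carrier A; b \<in> carrier A; c \<in> carrier A\<rbrakk> \<Longrightarrow> (a \<ominus> b) \<otimes> c = a \<otimes> c \<ominus> b \<otimes> c"
  by (simp_all add: a_minus_def vs.neg_eq_smult mult_l_distr mult_r_distr mult_closed
      mult_smult smult_mult)

lemma left_ideal_carrier: "left_ideal A (carrier A)"
  by (simp add: left_ideal_def carrier_is_submodule mult_closed)

lemma continuous_rep_left_ideal:
  assumes L: "left_ideal A L"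
  shows "continuous_rep A (A\<lparr>carrier := L\<rparr>) (\<otimes>)"
proof -
  let ?X = "A\<lparr>carrier := L\<rparr>"
  have sub: "submodule L complex_field A" and ab: "\<And>a x. \<lbrakk>a \<in> carrier A; x \<in> L\<rbrakk> \<Longrightarrow> a \<otimes> x \<in> L"
    using L by (auto simp: left_ideal_def)
  have LA: "x \<in> carrier A" if "x \<in> L" for x
    using vs.submodule_vsE(1)[OF sub] that by blast
  interpret X: normed_space ?X
    by (rule normed_space_submodule[OF sub])
  have lin: "linear_between ?X ?X ((\<otimes>) a)" if "a \<in> carrier A" for a
    using that by (auto simp: linear_between_def ab LA mult_r_distr mult_smult)
  have bound: "nrm A (a \<otimes> x) \<le> nrm A a * nrm A x" if "a \<in> carrier A" "x \<in> L" for a x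
    using that LA by (simp add: nrm_mult_le)
  show ?thesis
    unfolding continuous_rep_def
  proof (intro conjI ballI exI[of _ 1])
    show "normed_space ?X" ..
    show "representation A ?X (\<otimes>)"
      unfolding representation_def
      by (auto simp: lin LA mult_l_distr mult_assoc smult_mult X.module_axioms)
    fix a assume a: "a \<in> carrier A"
    show "bounded_op ?X ((\<otimes>) a)"
      using lin bound a by (auto simp: bounded_op_def)
    show "op_norm ?X ((\<otimes>) a) \<le> 1 * nrm A a"
      unfolding op_norm_def
    proof (rule cSup_least)
      have "\<zero> \<in> L"
        using vs.submodule_vsE(2)[OF sub] .
      then have "nrm ?X (a \<otimes> \<zero>) \<in> {nrm ?X (a \<otimes> x) | x. x \<in> carrier ?X \<and> nrm ?X x \<le> 1}"
        by (intro CollectI exI[of _ \<zero>]) simp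
      then show "{nrm ?X (a \<otimes> x) | x. x \<in> carrier ?X \<and> nrm ?X x \<le> 1} \<noteq> {}"
        by blast
      fix r assume "r \<in> {nrm ?X (a \<otimes> x) | x. x \<in> carrier ?X \<and> nrm ?X x \<le> 1}"
      then obtain x where x: "x \<in> L" "nrm A x \<le> 1" "r = nrm A (a \<otimes> x)"
        by auto
      have "nrm A a * nrm A x \<le> nrm A a * 1"
        using x nrm_nonneg[OF a] by (intro mult_left_mono) auto
      then show "r \<le> 1 * nrm A a"
        using bound[OF a x(1)] x(3) by simp
    qed
  qed
qed

lemma left_ideal_principal:
  assumes "x \<in> carrier A"
  shows "left_ideal A ((\<lambda>a. a \<otimes> x) ` carrier A)"
proof -
  interpret algebra_rep A "A\<lparr>carrier := carrier A\<rparr>" "(\<otimes>)"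
    using continuous_rep_left_ideal[OF left_ideal_carrier] normed_algebra_axioms
    by (intro algebra_repI) (auto simp: continuous_rep_def)
  show ?thesis
    using submodule_orbit[of x] assms by (auto simp: left_ideal_def mult_assoc[symmetric] mult_closed)
qed

text \<open>
  A left ideal is proper if and only if it misses the unit, and this property passes to unions of
  chains.
\<close>

lemma maximal_left_ideal:
  assumes e: "is_unit_of A e" and L: "left_ideal A L" "e \<notin> L"
  obtains M where "left_ideal A M" "L \<subseteq> M" "e \<notin> M"
    "\<And>N. \<lbrakk>left_ideal A N; M \<subseteq> N; e \<notin> N\<rbrakk> \<Longrightarrow> N = M"
proof -
  let ?S = "{M. left_ideal A M \<and> L \<subseteq> M \<and> e \<notin> M}"
  have "\<exists>M\<in>?S. \<forall>N\<in>?S. M \<subseteq> N \<longrightarrow> N = M"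
  proof (rule subset_Zorn_nonempty)
    show "?S \<noteq> {}"
      using L by blast
    fix \<C> assume "\<C> \<noteq> {}" and chain: "subset.chain ?S \<C>"
    then have C: "left_ideal A N" "L \<subseteq> N" "e \<notin> N" if "N \<in> \<C>" for N
      using that by (auto simp: subset.chain_def)
    note sub = vs.submodule_vsE[OF C(1)[unfolded left_ideal_def, THEN conjunct1]]
    have "submodule (\<Union>\<C>) complex_field A"
    proof (rule vs.submodule_vsI)
      fix x y assume "x \<in> \<Union>\<C>" "y \<in> \<Union>\<C>"
      then obtain N1 N2 where N: "N1 \<in> \<C>" "N2 \<in> \<C>" "x \<in> N1" "y \<in> N2"
        by blast
      moreover have "N1 \<subseteq> N2 \<or> N2 \<subseteq> N1"
        using chain N unfolding subset.chain_def by blast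
      ultimately show "x \<oplus> y \<in> \<Union>\<C>"
        using sub(3) by blast
    next
      show "\<Union>\<C> \<subseteq> carrier A"
        using sub(1) by blast
      show "\<zero> \<in> \<Union>\<C>"
        using sub(2) \<open>\<C> \<noteq> {}\<close> by blast
    next
      fix c x assume "x \<in> \<Union>\<C>"
      then obtain N where "N \<in> \<C>" "x \<in> N"
        by blast
      then show "c \<odot> x \<in> \<Union>\<C>"
        using sub(4)[of N x c] by blast
    qed
    moreover have "\<forall>a\<in>carrier A. \<forall>x\<in>\<Union>\<C>. a \<otimes> x \<in> \<Union>\<C>"
      using C(1) unfolding left_ideal_def by blast
    moreover have "L \<subseteq> \<Union>\<C>" "e \<notin> \<Union>\<C>"
      using C(2,3) \<open>\<C> \<noteq> {}\<close> by blast+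
    ultimately show "\<Union>\<C> \<in> ?S"
      by (simp add: left_ideal_def)
  qed
  then obtain M where M: "M \<in> ?S" "\<forall>N\<in>?S. M \<subseteq> N \<longrightarrow> N = M"
    by blast
  show thesis
    by (rule that[of M]) (use M in auto)
qed

text \<open>
  An element \<open>x\<close> without left inverse generates a proper left ideal. It lies in a maximal left ideal
  \<open>M\<close>, and the coset \<open>z\<close> of the unit is a nonzero vector of the simple quotient by \<open>M\<close> that \<open>x\<close> kills.
\<close>

lemma no_left_inverse_imp_annihilated_vector:
  assumes e: "is_unit_of A e" and x: "x \<in> carrier A" "\<not> (\<exists>y\<in>carrier A. y \<otimes> x = e)"
  obtains Y :: "(complex, 'a set) module" and \<tau> z
  where "strictly_irreducible A Y \<tau>" "\<And>v. v \<in> carrier Y \<Longrightarrow> \<tau> e v = v"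
    "z \<in> carrier Y" "z \<noteq> \<zero>\<^bsub>Y\<^esub>" "\<tau> x z = \<zero>\<^bsub>Y\<^esub>"
proof -
  have e': "e \<in> carrier A" "\<And>a. a \<in> carrier A \<Longrightarrow> e \<otimes> a = a" "\<And>a. a \<in> carrier A \<Longrightarrow> a \<otimes> e = a"
    using e by (auto simp: is_unit_of_def)
  have "e \<notin> (\<lambda>a. a \<otimes> x) ` carrier A"
    using x(2) by auto
  then obtain M where M: "left_ideal A M" "(\<lambda>a. a \<otimes> x) ` carrier A \<subseteq> M" "e \<notin> M"
    and max: "\<And>N. \<lbrakk>left_ideal A N; M \<subseteq> N; e \<notin> N\<rbrakk> \<Longrightarrow> N = M"
    using maximal_left_ideal[OF e left_ideal_principal[OF x(1)]] by metis
  have xM: "x \<in> M"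
    using M(2) e' x(1) by (metis image_subset_iff)
  have reg: "representation A A (\<otimes>)"
    using continuous_rep_left_ideal[OF left_ideal_carrier] by (simp add: continuous_rep_def)
  have sub: "submodule M complex_field A" "\<forall>a\<in>carrier A. (\<otimes>) a ` M \<subseteq> M"
    using M(1) by (auto simp: left_ideal_def)
  obtain Y :: "(complex, 'a set) module" and \<tau> q
    where rep: "representation A Y \<tau>" and lin: "linear_between A Y q" and im: "q ` carrier A = carrier Y"
      and ker: "\<And>x. x \<in> carrier A \<Longrightarrow> q x = \<zero>\<^bsub>Y\<^esub> \<longleftrightarrow> x \<in> M"
      and tau: "\<And>a x. \<lbrakk>a \<in> carrier A; x \<in> carrier A\<rbrakk> \<Longrightarrow> \<tau> a (q x) = q (a \<otimes> x)"
    by (rule quotient_representation[OF normed_algebra_axioms reg sub]) (rule that; assumption)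
  interpret algebra_rep A Y \<tau>
    using normed_algebra_axioms rep by (rule algebra_repI)
  have im': "carrier Y = q ` carrier A"
    using im by simp
  have qlin: "q (a \<oplus> b) = q a \<oplus>\<^bsub>Y\<^esub> q b" "q (c \<odot> a) = c \<odot>\<^bsub>Y\<^esub> q a"
    if "a \<in> carrier A" "b \<in> carrier A" for a b c
    using lin that by (auto simp: linear_between_def)
  have id: "\<tau> e v = v" if "v \<in> carrier Y" for v
    using that e' by (auto simp: im' tau)
  have z: "q e \<in> carrier Y" "q e \<noteq> \<zero>\<^bsub>Y\<^esub>" "\<tau> x (q e) = \<zero>\<^bsub>Y\<^esub>"
    using e' x(1) xM M(3) ker im by (auto simp: tau)
  have "strictly_irreducible A Y \<tau>"
    unfolding strictly_irreducible_def
  proof (intro conjI allI impI)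
    have "\<tau> e (q e) \<noteq> \<zero>\<^bsub>Y\<^esub>"
      using id z by simp
    then show "rep_kernel A Y \<tau> \<noteq> carrier A"
      using e'(1) z(1) by (auto simp: rep_kernel_def)
    fix E assume E: "submodule E complex_field Y \<and> (\<forall>a\<in>carrier A. \<tau> a ` E \<subseteq> E)"
    note sub = X.submodule_vsE[OF conjunct1[OF E]]
    let ?N = "{a \<in> carrier A. q a \<in> E}"
    have N: "left_ideal A ?N"
      unfolding left_ideal_def
    proof (intro conjI ballI vs.submodule_vsI)
      fix a b assume a: "a \<in> carrier A" and b: "b \<in> ?N"
      then have "\<tau> a (q b) \<in> E"
        using E by blast
      then show "a \<otimes> b \<in> ?N"
        using a b by (simp add: tau mult_closed)
    next
      have "q \<zero> = \<zero>\<^bsub>Y\<^esub>"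
        using ker[of \<zero>] M(1) vs.submodule_vsE(2) by (simp add: left_ideal_def)
      then show "\<zero> \<in> ?N"
        using sub(2) by simp
    qed (use sub in \<open>auto simp: qlin\<close>)
    have MN: "M \<subseteq> ?N"
    proof
      fix m assume m: "m \<in> M"
      then have "m \<in> carrier A"
        using M(1) vs.submodule_vsE(1) by (auto simp: left_ideal_def)
      moreover from this have "q m = \<zero>\<^bsub>Y\<^esub>"
        using m ker by simp
      ultimately show "m \<in> ?N"
        using sub(2) by simp
    qed
    have EN: "E = q ` ?N"
      using sub(1) unfolding im' by blast
    show "E = {\<zero>\<^bsub>Y\<^esub>} \<or> E = carrier Y"
    proof (cases "e \<in> ?N")
      case True
      have "q a \<in> E" if a: "a \<in> carrier A" for a
      proof -
        have "a \<otimes> e \<in> ?N"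
          using N a True unfolding left_ideal_def by blast
        then show ?thesis
          using e'(3)[OF a] by simp
      qed
      then have "carrier Y \<subseteq> E"
        unfolding im' by blast
      then show ?thesis
        using sub(1) by blast
    next
      case False
      then have "?N = M"
        using max[OF N MN] by blast
      then have "q a = \<zero>\<^bsub>Y\<^esub>" if "a \<in> carrier A" "q a \<in> E" for a
        using ker[of a] that by blast
      then have "E \<subseteq> {\<zero>\<^bsub>Y\<^esub>}"
        using EN by blast
      then show ?thesis
        using sub(2) by blast
    qed
  qed (rule rep)
  then show thesis
    using that[of Y \<tau> "q e"] id z by blast
qed

end

section \<open>Q-algebras\<close>

context normed_algebra
begin

text \<open>
  The idempotent \<open>p = e - xy\<close> satisfies \<open>px = 0\<close>, hence \<open>p = - p(x - e)\<close>, so \<open>p\<close> is at most as large as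
  \<open>\<parallel>p\<parallel> \<parallel>x - e\<parallel> < \<parallel>p\<parallel>\<close> unless it vanishes.
\<close>

lemma left_inverse_near_unit_is_inverse:
  assumes e: "is_unit_of A e" and x: "x \<in> carrier A" "nrm A (x \<ominus> e) < 1"
    and y: "y \<in> carrier A" "y \<otimes> x = e"
  shows "x \<otimes> y = e"
proof -
  have e': "e \<in> carrier A" "\<And>a. a \<in> carrier A \<Longrightarrow> e \<otimes> a = a" "\<And>a. a \<in> carrier A \<Longrightarrow> a \<otimes> e = a"
    using e by (auto simp: is_unit_of_def)
  define p where "p = e \<ominus> x \<otimes> y"
  have p: "p \<in> carrier A"
    using e' x y by (simp add: p_def mult_closed)
  have "p \<otimes> x = \<zero>"
    using e' x y by (simp add: p_def mult_minus mult_closed mult_assoc vs.minus_eq_zero_iff)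
  then have "p \<otimes> (x \<ominus> e) = \<ominus> p"
    using e' x p by (simp add: mult_minus) (simp add: a_minus_def)
  then have "nrm A p = nrm A (p \<otimes> (x \<ominus> e))"
    using p by (simp add: nrm_uminus)
  also have "\<dots> \<le> nrm A p * nrm A (x \<ominus> e)"
    using p x e' by (intro nrm_mult_le) simp_all
  finally have "nrm A p * (1 - nrm A (x \<ominus> e)) \<le> 0"
    by (simp add: algebra_simps)
  then have "nrm A p \<le> 0"
    using x(2) by (simp add: mult_le_0_iff)
  then have "p = \<zero>"
    using p nrm_pos by fastforce
  then show ?thesis
    using e' x y vs.minus_eq_zero_iff[of e "x \<otimes> y"] by (simp add: p_def mult_closed)
qed

text \<open>
  Multiplication by the inverse \<open>w\<close> of \<open>u\<close> moves a neighbourhood of \<open>u\<close> into the unit ball around \<open>e\<close>.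
\<close>

lemma open_units_if_near_unit_left_invertible:
  assumes e: "is_unit_of A e"
    and inv: "\<And>x. \<lbrakk>x \<in> carrier A; nrm A (x \<ominus> e) < 1\<rbrakk> \<Longrightarrow> \<exists>y\<in>carrier A. y \<otimes> x = e"
  shows "openin (mtopology_of (norm_metric A))
    {x \<in> carrier A. \<exists>y\<in>carrier A. y \<otimes> x = e \<and> x \<otimes> y = e}" (is "openin _ ?G")
proof -
  interpret d: Metric_space "carrier A" "norm_dist A"
    by (rule Metric_space_norm_dist)
  have e': "e \<in> carrier A" "\<And>a. a \<in> carrier A \<Longrightarrow> e \<otimes> a = a" "\<And>a. a \<in> carrier A \<Longrightarrow> a \<otimes> e = a"
    using e by (auto simp: is_unit_of_def)
  have "\<exists>r>0. d.mball u r \<subseteq> ?G" if u: "u \<in> ?G" for u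
  proof -
    obtain w where w: "w \<in> carrier A" "w \<otimes> u = e" "u \<otimes> w = e"
      using u by blast
    have uA: "u \<in> carrier A"
      using u by blast
    define r where "r = 1 / (nrm A w + 1)"
    have r: "r > 0"
      using nrm_nonneg[OF w(1)] by (simp add: r_def)
    have "v \<in> ?G" if v: "v \<in> d.mball u r" for v
    proof -
      have vA: "v \<in> carrier A" and dist: "nrm A (v \<ominus> u) < r"
        using v uA nrm_minus_commute[of u v] by (auto simp: norm_dist_def)
      have "nrm A (w \<otimes> v \<ominus> e) = nrm A (w \<otimes> (v \<ominus> u))"
        using w uA vA by (simp add: mult_minus)
      also have "\<dots> \<le> nrm A w * nrm A (v \<ominus> u)"
        using w uA vA by (intro nrm_mult_le) simp_all
      also have "\<dots> \<le> nrm A w * r"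
        using dist nrm_nonneg[OF w(1)] by (intro mult_left_mono) simp_all
      also have "\<dots> < 1"
        using nrm_nonneg[OF w(1)] by (simp add: r_def field_simps)
      finally have near: "nrm A (w \<otimes> v \<ominus> e) < 1" .
      have wv: "w \<otimes> v \<in> carrier A"
        using w vA by (simp add: mult_closed)
      then obtain y where y: "y \<in> carrier A" "y \<otimes> (w \<otimes> v) = e"
        using inv near by blast
      then have "(w \<otimes> v) \<otimes> y = e"
        using left_inverse_near_unit_is_inverse[OF e wv near] by simp
      then have "u \<otimes> ((w \<otimes> v) \<otimes> y) \<otimes> w = e"
        using w uA e' by simp
      moreover have "u \<otimes> ((w \<otimes> v) \<otimes> y) \<otimes> w = ((u \<otimes> w) \<otimes> v) \<otimes> (y \<otimes> w)"
        using w(1) uA vA y(1) by (simp add: mult_assoc mult_closed)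
      ultimately have "v \<otimes> (y \<otimes> w) = e"
        using w vA e' by simp
      moreover have "(y \<otimes> w) \<otimes> v = e"
        using w vA y by (simp add: mult_assoc)
      moreover have "y \<otimes> w \<in> carrier A"
        using w y by (simp add: mult_closed)
      ultimately show ?thesis
        using vA by blast
    qed
    then show ?thesis
      using r by blast
  qed
  then show ?thesis
    unfolding Metric_space_norm_metric d.openin_mtopology by blast
qed

lemma carrier_unitization: "x \<in> carrier (unitization A) \<longleftrightarrow>
    fst x \<in> carrier A \<and> (unital A \<longrightarrow> snd x = 0)"
  by (auto simp: unitization_def mem_Times_iff)

lemma unitization_ops:
  "x \<oplus>\<^bsub>unitization A\<^esub> y = (fst x \<oplus> fst y, snd x + snd y)"
  "x \<otimes>\<^bsub>unitization A\<^esub> y =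
    (fst x \<otimes> fst y \<oplus> (snd x \<odot> fst y \<oplus> snd y \<odot> fst x), snd x * snd y)"
  "c \<odot>\<^bsub>unitization A\<^esub> x = (c \<odot> fst x, c * snd x)"
  "\<zero>\<^bsub>unitization A\<^esub> = (\<zero>, 0)"
  "nrm (unitization A) x = nrm A (fst x) + cmod (snd x)"
  by (simp_all add: unitization_def case_prod_beta)

lemma embed_unitization:
  assumes "a \<in> carrier A"
  shows "(a, 0) \<in> carrier (unitization A)" "c \<odot>\<^bsub>unitization A\<^esub> (a, 0) = (c \<odot> a, 0)"
    "b \<in> carrier A \<Longrightarrow> (a, 0) \<oplus>\<^bsub>unitization A\<^esub> (b, 0) = (a \<oplus> b, 0)"
    "b \<in> carrier A \<Longrightarrow> (a, 0) \<otimes>\<^bsub>unitization A\<^esub> (b, 0) = (a \<otimes> b, 0)"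
  using assms by (simp_all add: carrier_unitization unitization_ops mult_closed)

lemma is_unit_of_one_unitization: "is_unit_of (unitization A) \<one>\<^bsub>unitization A\<^esub>"
proof (cases "unital A")
  case True
  then obtain e where e: "is_unit_of A e"
    by (auto simp: unital_def)
  have "(THE e. is_unit_of A e) = e"
    using e by (intro the_equality) (metis is_unit_of_def)+
  then have "\<one>\<^bsub>unitization A\<^esub> = (e, 0)"
    using True by (simp add: unitization_def)
  then show ?thesis
    using True e
    by (auto simp: is_unit_of_def carrier_unitization unitization_ops prod_eq_iff)
next
  case False
  then have "\<one>\<^bsub>unitization A\<^esub> = (\<zero>, 1)"
    by (simp add: unitization_def)
  then show ?thesis
    using False
    by (auto simp: is_unit_of_def carrier_unitization unitization_ops prod_eq_iff)
qed

lemma unitization_decomp: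
  assumes "u \<in> carrier (unitization A)"
  shows "u = (fst u, 0) \<oplus>\<^bsub>unitization A\<^esub> snd u \<odot>\<^bsub>unitization A\<^esub> \<one>\<^bsub>unitization A\<^esub>"
proof -
  have one: "fst \<one>\<^bsub>unitization A\<^esub> \<in> carrier A"
    using is_unit_of_one_unitization by (simp add: is_unit_of_def carrier_unitization)
  show ?thesis
  proof (cases "unital A")
    case True
    then show ?thesis
      using assms one by (simp add: carrier_unitization unitization_ops prod_eq_iff)
  next
    case False
    then have "\<one>\<^bsub>unitization A\<^esub> = (\<zero>, 1)"
      by (simp add: unitization_def)
    then show ?thesis
      using assms by (simp add: carrier_unitization unitization_ops prod_eq_iff)
  qed
qed

lemma Q_algebrasI:
  assumes "\<And>x. \<lbrakk>x \<in> carrier (unitization A);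
      nrm (unitization A) (x \<ominus>\<^bsub>unitization A\<^esub> \<one>\<^bsub>unitization A\<^esub>) < 1\<rbrakk>
    \<Longrightarrow> \<exists>y\<in>carrier (unitization A). y \<otimes>\<^bsub>unitization A\<^esub> x = \<one>\<^bsub>unitization A\<^esub>"
  shows "A \<in> Q_algebras"
proof -
  interpret U: normed_algebra "unitization A"
    by (rule normed_algebra_unitization)
  show ?thesis
    using U.open_units_if_near_unit_left_invertible[OF is_unit_of_one_unitization assms]
      normed_algebra_axioms
    by (simp add: Q_algebras_def Units_def)
qed

lemma representation_restrict:
  assumes "representation (unitization A) X \<pi>"
  shows "representation A X (\<lambda>a. \<pi> (a, 0))"
  using assms
  unfolding representation_def
  by (auto simp: embed_unitization(1) embed_unitization(2-4)[symmetric])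

text \<open>
  Since \<open>1\<close> acts as the identity, every subspace invariant under \<open>A\<close> is invariant under the
  unitization.
\<close>

lemma strictly_irreducible_restrict:
  assumes irr: "strictly_irreducible (unitization A) X \<pi>"
    and one: "\<And>v. v \<in> carrier X \<Longrightarrow> \<pi> \<one>\<^bsub>unitization A\<^esub> v = v"
    and a: "a \<in> carrier A" "v \<in> carrier X" "\<pi> (a, 0) v \<noteq> \<zero>\<^bsub>X\<^esub>"
  shows "strictly_irreducible A X (\<lambda>a. \<pi> (a, 0))"
proof -
  have rep: "representation (unitization A) X \<pi>"
    using irr by (simp add: strictly_irreducible_def)
  interpret algebra_rep "unitization A" X \<pi>
    using normed_algebra_unitization rep by (rule algebra_repI)
  show ?thesis
    unfolding strictly_irreducible_def
  proof (intro conjI allI impI)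
    show "representation A X (\<lambda>a. \<pi> (a, 0))"
      using rep by (rule representation_restrict)
    have "a \<notin> rep_kernel A X (\<lambda>a. \<pi> (a, 0))"
      using a(2,3) unfolding rep_kernel_def by blast
    then show "rep_kernel A X (\<lambda>a. \<pi> (a, 0)) \<noteq> carrier A"
      using a(1) by blast
    fix E assume E: "submodule E complex_field X \<and> (\<forall>a\<in>carrier A. \<pi> (a, 0) ` E \<subseteq> E)"
    note sub = X.submodule_vsE[OF conjunct1[OF E]]
    have "\<pi> u x \<in> E" if u: "u \<in> carrier (unitization A)" and x: "x \<in> E" for u x
    proof -
      have xX: "x \<in> carrier X"
        using sub(1) x by blast
      have fu: "fst u \<in> carrier A"
        using u by (simp add: carrier_unitization)
      have one_cl: "\<one>\<^bsub>unitization A\<^esub> \<in> carrier (unitization A)"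
        using is_unit_of_one_unitization by (simp add: is_unit_of_def)
      have "\<pi> u x = \<pi> (fst u, 0) x \<oplus>\<^bsub>X\<^esub> snd u \<odot>\<^bsub>X\<^esub> x"
        using xX fu one_cl one[OF xX]
        by (subst unitization_decomp[OF u]) (simp add: act_hom embed_unitization(1))
      moreover have "\<pi> (fst u, 0) x \<in> E"
        using E fu x by blast
      ultimately show ?thesis
        using sub(3,4) x by simp
    qed
    then show "E = {\<zero>\<^bsub>X\<^esub>} \<or> E = carrier X"
      using irr E unfolding strictly_irreducible_def by blast
  qed
qed

end

text \<open>
  If \<open>x = (1 + s)1 + a\<close> with \<open>\<parallel>a\<parallel> + \<bar>s\<bar> < 1\<close> had no left inverse, then \<open>x\<close> would kill a vector \<open>z \<noteq> 0\<close> of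
  some irreducible representation of the unitization, that is, \<open>az = - (1 + s)z\<close>. The representation
  stays irreducible on \<open>A\<close>, so it is equivalent to a continuous one, where no eigenvalue of \<open>a\<close>
  exceeds \<open>\<parallel>a\<parallel>\<close> in absolute value. But \<open>\<bar>1 + s\<bar> \<ge> 1 - \<bar>s\<bar> > \<parallel>a\<parallel>\<close>.
\<close>

lemma Qb_algebra_is_Q_algebra:
  fixes A :: "'a normed"
  assumes "A \<in> Qb_algebras"
  shows "A \<in> Q_algebras"
proof -
  have A: "normed_algebra A"
    and Qb: "\<And>(X :: (complex, 'a set) module) \<pi>. strictly_irreducible A X \<pi> \<Longrightarrow>
      \<exists>(Y :: 'a set normed) \<tau>. banach_space Y \<and> continuous_rep A Y \<tau> \<and>
        strictly_irreducible A Y \<tau> \<and> equivalent_reps A X \<pi> Y \<tau>"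
    using assms by (simp_all add: Qb_algebras_def)
  interpret normed_algebra A
    by (rule A)
  let ?U = "unitization A"
  interpret U: normed_algebra ?U
    by (rule normed_algebra_unitization)
  have one: "\<one>\<^bsub>?U\<^esub> \<in> carrier ?U"
    using is_unit_of_one_unitization by (simp add: is_unit_of_def)
  show ?thesis
  proof (rule Q_algebrasI, rule ccontr)
    fix x assume x: "x \<in> carrier ?U" and near: "nrm ?U (x \<ominus>\<^bsub>?U\<^esub> \<one>\<^bsub>?U\<^esub>) < 1"
      and no_inv: "\<not> (\<exists>y\<in>carrier ?U. y \<otimes>\<^bsub>?U\<^esub> x = \<one>\<^bsub>?U\<^esub>)"
    obtain X :: "(complex, ('a \<times> complex) set) module" and \<pi> z
      where irr: "strictly_irreducible ?U X \<pi>"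
        and id: "\<And>v. v \<in> carrier X \<Longrightarrow> \<pi> \<one>\<^bsub>?U\<^esub> v = v"
        and z: "z \<in> carrier X" "z \<noteq> \<zero>\<^bsub>X\<^esub>" "\<pi> x z = \<zero>\<^bsub>X\<^esub>"
      by (rule U.no_left_inverse_imp_annihilated_vector[OF is_unit_of_one_unitization x no_inv]) blast
    interpret algebra_rep ?U X \<pi>
      using normed_algebra_unitization irr by (intro algebra_repI) (simp_all add: strictly_irreducible_def)
    define u where "u = x \<ominus>\<^bsub>?U\<^esub> \<one>\<^bsub>?U\<^esub>"
    define a where "a = fst u"
    define s where "s = snd u"
    have u: "u \<in> carrier ?U"
      using x one by (simp add: u_def)
    have a: "a \<in> carrier A" "(a, 0) \<in> carrier ?U"
      using u by (simp_all add: a_def carrier_unitization)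
    have small: "nrm A a + cmod s < 1"
      using near by (simp add: u_def[symmetric] unitization_ops a_def s_def)
    have "x = u \<oplus>\<^bsub>?U\<^esub> \<one>\<^bsub>?U\<^esub>"
      using x one by (simp add: u_def U.vs.minus_add_cancel)
    also have "\<dots> = ((a, 0) \<oplus>\<^bsub>?U\<^esub> s \<odot>\<^bsub>?U\<^esub> \<one>\<^bsub>?U\<^esub>) \<oplus>\<^bsub>?U\<^esub> \<one>\<^bsub>?U\<^esub>"
      using unitization_decomp[OF u] by (simp add: a_def s_def)
    finally have "\<pi> x z = (\<pi> (a, 0) z \<oplus>\<^bsub>X\<^esub> s \<odot>\<^bsub>X\<^esub> z) \<oplus>\<^bsub>X\<^esub> z"
      using a one z(1) id by (simp add: act_hom)
    also have "\<dots> = \<pi> (a, 0) z \<oplus>\<^bsub>X\<^esub> (s + 1) \<odot>\<^bsub>X\<^esub> z"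
      using a z(1) by (simp add: X.smult_distribs X.M.a_assoc)
    finally have "\<pi> (a, 0) z = \<ominus>\<^bsub>X\<^esub> ((s + 1) \<odot>\<^bsub>X\<^esub> z)"
      using a z X.M.minus_equality by (metis X.smult_cl act_closed X.M.minus_minus)
    then have eig: "\<pi> (a, 0) z = (- (s + 1)) \<odot>\<^bsub>X\<^esub> z"
      using z(1) by (simp add: X.neg_eq_smult)
    have large: "nrm A a < cmod (- (s + 1))"
      using small norm_triangle_ineq2[of 1 "- s"] by (simp add: norm_minus_commute add.commute)
    then have "- (s + 1) \<noteq> 0"
      using nrm_nonneg[OF a(1)] by auto
    then have "\<pi> (a, 0) z \<noteq> \<zero>\<^bsub>X\<^esub>"
      using eig z X.smult_eq_zero_iff by simp
    then have irrA: "strictly_irreducible A X (\<lambda>a. \<pi> (a, 0))"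
      using strictly_irreducible_restrict[OF irr id a(1) z(1)] by blast
    then obtain X' :: "(complex, 'a set) module" and \<pi>'
      where X': "strictly_irreducible A X' \<pi>'" "equivalent_reps A X (\<lambda>a. \<pi> (a, 0)) X' \<pi>'"
      using strictly_irreducible_universe[OF A] by blast
    then obtain Y :: "'a set normed" and \<tau>
      where Y: "continuous_rep A Y \<tau>" "equivalent_reps A X' \<pi>' Y \<tau>"
      using Qb by blast
    note reps = irrA[unfolded strictly_irreducible_def, THEN conjunct1]
      X'(1)[unfolded strictly_irreducible_def, THEN conjunct1]
      Y(1)[unfolded continuous_rep_def, THEN conjunct2, THEN conjunct1]
    obtain z' where z': "z' \<in> carrier X'" "z' \<noteq> \<zero>\<^bsub>X'\<^esub>" "\<pi>' a z' = (- (s + 1)) \<odot>\<^bsub>X'\<^esub> z'"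
      by (rule equivalent_reps_eigenvector[OF A reps(1,2) X'(2) a(1) z(1,2) eig])
    obtain w where w: "w \<in> carrier Y" "w \<noteq> \<zero>\<^bsub>Y\<^esub>" "\<tau> a w = (- (s + 1)) \<odot>\<^bsub>Y\<^esub> w"
      by (rule equivalent_reps_eigenvector[OF A reps(2,3) Y(2) a(1) z'])
    have "cmod (- (s + 1)) \<le> nrm A a"
      by (rule continuous_rep_eigenvalue_bound[OF A Y(1) a(1) w])
    then show False
      using large by simp
  qed
qed

section \<open>Minimal left ideals with finitely supported coordinates\<close>

text \<open>
  In an algebra of finite matrices, \<open>e\<close>, \<open>p i\<close> and \<open>r i\<close> are the matrix units at the positions
  \<open>(0, 0)\<close>, \<open>(0, i)\<close> and \<open>(i, 0)\<close>. The left ideal \<open>Ae\<close> consists of the matrices supported in the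
  first column, and left multiplication by \<open>p i\<close> extracts the \<open>i\<close>-th entry of such a column. The
  assumptions say that these coordinates are scalars, determine the column, and that none of the
  columns has all its coordinates nonzero.
\<close>

locale coordinatized_left_ideal = normed_algebra A for A :: "'a normed" (structure) +
  fixes e :: 'a and p r :: "nat \<Rightarrow> 'a"
  assumes p_closed [simp]: "p i \<in> carrier A"
    and r_closed [simp]: "r i \<in> carrier A"
    and e_nonzero: "e \<noteq> \<zero>"
    and p_0: "p 0 = e" and r_0: "r 0 = e"
    and p_mult_r: "p i \<otimes> r j = (if i = j then e else \<zero>)"
    and coordinate_scalar: "a \<in> carrier A \<Longrightarrow> \<exists>c. p i \<otimes> (a \<otimes> e) = c \<odot> e"
    and coordinates_separate: "\<lbrakk>a \<in> carrier A; a \<otimes> e \<noteq> \<zero>\<rbrakk> \<Longrightarrow> \<exists>i. p i \<otimes> (a \<otimes> e) \<noteq> \<zero>"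
    and coordinate_vanishes: "a \<in> carrier A \<Longrightarrow> \<exists>i. p i \<otimes> (a \<otimes> e) = \<zero>"
begin

lemma e_closed [simp]: "e \<in> carrier A"
  using p_closed[of 0] by (simp only: p_0)

lemma e_idem [simp]: "e \<otimes> e = e"
  using p_mult_r[of 0 0] by (simp add: p_0 r_0)

definition ideal_space :: "'a normed"
  where "ideal_space = A\<lparr>carrier := (\<lambda>a. a \<otimes> e) ` carrier A\<rparr>"

lemma ideal_space_simps [simp]:
  "carrier ideal_space = (\<lambda>a. a \<otimes> e) ` carrier A" "\<zero>\<^bsub>ideal_space\<^esub> = \<zero>"
  "c \<odot>\<^bsub>ideal_space\<^esub> x = c \<odot> x"
  by (simp_all add: ideal_space_def)

lemma e_in_ideal_space: "e \<in> carrier ideal_space"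
  by (simp add: image_eqI[of e _ e])

lemma continuous_rep_ideal_space: "continuous_rep A ideal_space (\<otimes>)"
  unfolding ideal_space_def by (intro continuous_rep_left_ideal left_ideal_principal e_closed)

text \<open>
  A nonzero column is carried to \<open>e\<close> by a multiple of some \<open>p i\<close>, and from there to every column.
\<close>

lemma strictly_irreducible_ideal_space: "strictly_irreducible A ideal_space (\<otimes>)"
proof -
  interpret algebra_rep A ideal_space "(\<otimes>)"
    using normed_algebra_axioms continuous_rep_ideal_space
    by (intro algebra_repI) (simp_all add: continuous_rep_def)
  show ?thesis
  proof (rule strictly_irreducible_if_transitive)
    show "e \<in> carrier ideal_space"
      by (rule e_in_ideal_space)
    show "e \<noteq> \<zero>\<^bsub>ideal_space\<^esub>"
      using e_nonzero by simp
    fix v w assume v: "v \<in> carrier ideal_space" "v \<noteq> \<zero>\<^bsub>ideal_space\<^esub>" and w: "w \<in> carrier ideal_space"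
    obtain a where a: "a \<in> carrier A" "v = a \<otimes> e"
      using v by auto
    obtain b where b: "b \<in> carrier A" "w = b \<otimes> e"
      using w by auto
    obtain i where i: "p i \<otimes> v \<noteq> \<zero>"
      using coordinates_separate a v by auto
    obtain c where c: "p i \<otimes> v = c \<odot> e"
      using coordinate_scalar[of a i] a by auto
    then have "c \<noteq> 0"
      using i by auto
    have vA: "v \<in> carrier A"
      using a by (simp add: mult_closed)
    have "(b \<otimes> (inverse c \<odot> p i)) \<otimes> v = b \<otimes> (inverse c \<odot> (p i \<otimes> v))"
      using b vA by (simp add: mult_assoc smult_mult)
    also have "\<dots> = w"
      using b c \<open>c \<noteq> 0\<close> by simp
    finally show "\<exists>a\<in>carrier A. a \<otimes> v = w"
      using b by (intro bexI[of _ "b \<otimes> (inverse c \<odot> p i)"]) (simp_all add: mult_closed)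
  qed
qed

text \<open>
  If \<open>e\<close> fixes a vector \<open>x\<^sub>0 \<noteq> 0\<close>, every vector of the representation space has the form \<open>bex\<^sub>0\<close> and so
  is killed by some \<open>p i\<close>. In a Banach space this is absurd: \<open>p i\<close> kills \<open>r j x\<^sub>0\<close> unless \<open>i = j\<close>, so that
  no \<open>p i\<close> kills the sum of an absolutely convergent series \<open>\<Sum>\<^sub>j c\<^sub>j r j x\<^sub>0\<close> with all \<open>c\<^sub>j \<noteq> 0\<close>.
\<close>

lemma banach_rep_kills_e:
  assumes Y: "banach_space Y" and cont: "continuous_rep A Y \<tau>"
    and irr: "strictly_irreducible A Y \<tau>" and y: "y \<in> carrier Y"
  shows "\<tau> e y = \<zero>\<^bsub>Y\<^esub>"
proof (rule ccontr)
  assume nonzero: "\<tau> e y \<noteq> \<zero>\<^bsub>Y\<^esub>"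
  interpret Y: normed_space Y
    using cont by (simp add: continuous_rep_def)
  interpret algebra_rep A Y \<tau>
    using normed_algebra_axioms cont by (intro algebra_repI) (simp_all add: continuous_rep_def)
  define x0 where "x0 = \<tau> e y"
  define x where "x = (\<lambda>i. \<tau> (r i) x0)"
  have x0: "x0 \<in> carrier Y" "x0 \<noteq> \<zero>\<^bsub>Y\<^esub>" "\<tau> e x0 = x0"
    using y nonzero by (simp_all add: x0_def act_hom(2)[symmetric])
  have x: "x i \<in> carrier Y" for i
    using x0 by (simp add: x_def)
  have px: "\<tau> (p i) (x j) = (if i = j then x0 else \<zero>\<^bsub>Y\<^esub>)" for i j
    using x0 by (simp add: x_def act_hom(2)[symmetric] p_mult_r)
  have "x i \<noteq> \<zero>\<^bsub>Y\<^esub>" for i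
    using px[of i i] x0 by auto
  then have nx: "nrm Y (x i) > 0" for i
    using x by (simp add: Y.nrm_pos)
  define c where "c = (\<lambda>i. complex_of_real ((1/2) ^ i / nrm Y (x i)))"
  have c: "c i \<noteq> 0" for i
    using nx[of i] by (simp add: c_def)
  have cn: "nrm Y (c i \<odot>\<^bsub>Y\<^esub> x i) \<le> (1/2) ^ i" for i
    using x nx[of i] by (simp add: Y.nrm_smult c_def norm_divide norm_power)
  define s where "s = rec_nat \<zero>\<^bsub>Y\<^esub> (\<lambda>n v. v \<oplus>\<^bsub>Y\<^esub> c n \<odot>\<^bsub>Y\<^esub> x n)"
  have s: "s 0 = \<zero>\<^bsub>Y\<^esub>" "s (Suc n) = s n \<oplus>\<^bsub>Y\<^esub> c n \<odot>\<^bsub>Y\<^esub> x n" for n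
    by (simp_all add: s_def)
  have sY: "s n \<in> carrier Y" for n
    by (induction n) (simp_all add: s x)
  have ps: "\<tau> (p i) (s n) = (if i < n then c i \<odot>\<^bsub>Y\<^esub> x0 else \<zero>\<^bsub>Y\<^esub>)" for i n
    by (induction n) (auto simp: s act_linear sY x x0 px less_Suc_eq)
  have cx: "c n \<odot>\<^bsub>Y\<^esub> x n \<in> carrier Y" for n
    using x by simp
  obtain z where z: "z \<in> carrier Y" and lim: "\<And>\<epsilon>. \<epsilon> > 0 \<Longrightarrow> \<exists>N. \<forall>n\<ge>N. nrm Y (s n \<ominus>\<^bsub>Y\<^esub> z) < \<epsilon>"
    by (rule banach_space_series[OF Y cx cn s]) blast
  have "(\<lambda>a. \<tau> a x0) ` carrier A = carrier Y"
    by (rule strictly_irreducible_orbit[OF irr x0(1) e_closed]) (simp add: x0)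
  then have "z \<in> (\<lambda>a. \<tau> a x0) ` carrier A"
    using z by simp
  then obtain b where b: "b \<in> carrier A" "z = \<tau> b x0"
    by blast
  then obtain i where i: "p i \<otimes> (b \<otimes> e) = \<zero>"
    using coordinate_vanishes by blast
  have "\<tau> (p i) z = \<tau> (p i \<otimes> (b \<otimes> e)) x0"
    using b x0 by (simp add: act_hom mult_closed)
  then have pz: "\<tau> (p i) z = \<zero>\<^bsub>Y\<^esub>"
    using i x0 by simp
  obtain K where K: "\<And>v. v \<in> carrier Y \<Longrightarrow> nrm Y (\<tau> (p i) v) \<le> K * nrm Y v"
    using cont p_closed[of i] unfolding continuous_rep_def bounded_op_def by blast
  define \<delta> where "\<delta> = nrm Y (c i \<odot>\<^bsub>Y\<^esub> x0)"
  have \<delta>: "\<delta> > 0"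
    using c x0 Y.vs.smult_eq_zero_iff by (simp add: \<delta>_def Y.nrm_pos)
  then obtain N where N: "\<And>n. n \<ge> N \<Longrightarrow> nrm Y (s n \<ominus>\<^bsub>Y\<^esub> z) < \<delta> / (\<bar>K\<bar> + 1)"
    using lim[of "\<delta> / (\<bar>K\<bar> + 1)"] by (auto simp: add_nonneg_pos)
  \<comment> \<open>From \<open>n = i + 1\<close> on, the \<open>i\<close>-th coordinate of the partial sum \<open>s n\<close> is the final one.\<close>
  define n where "n = max N (Suc i)"
  have "i < n"
    by (simp add: n_def)
  then have "\<tau> (p i) (s n \<ominus>\<^bsub>Y\<^esub> z) = c i \<odot>\<^bsub>Y\<^esub> x0 \<ominus>\<^bsub>Y\<^esub> \<zero>\<^bsub>Y\<^esub>"
    using sY z by (simp add: act_minus ps pz)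
  also have "\<dots> = c i \<odot>\<^bsub>Y\<^esub> x0"
    using x0 Y.vs.neg_eq_smult[of "\<zero>\<^bsub>Y\<^esub>"] by (simp add: a_minus_def)
  finally have "\<delta> \<le> K * nrm Y (s n \<ominus>\<^bsub>Y\<^esub> z)"
    using K[of "s n \<ominus>\<^bsub>Y\<^esub> z"] sY z by (simp add: \<delta>_def)
  also have "\<dots> \<le> \<bar>K\<bar> * (\<delta> / (\<bar>K\<bar> + 1))"
    using N[of n] sY z by (intro mult_mono) (simp_all add: n_def Y.nrm_nonneg less_imp_le)
  also have "\<dots> < \<delta>"
    using \<delta> by (simp add: field_simps)
  finally show False
    by simp
qed

text \<open>
  Equivalence preserves the eigenvalue 1 of \<open>e\<close>, so the representation on \<open>Ae\<close> is not equivalent to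
  a continuous one on a Banach space.
\<close>

lemma not_Qb_algebra: "A \<notin> Qb_algebras"
proof
  assume "A \<in> Qb_algebras"
  then have Qb: "\<And>(X :: (complex, 'a set) module) \<pi>. strictly_irreducible A X \<pi> \<Longrightarrow>
      \<exists>(Y :: 'a set normed) \<tau>. banach_space Y \<and> continuous_rep A Y \<tau> \<and>
        strictly_irreducible A Y \<tau> \<and> equivalent_reps A X \<pi> Y \<tau>"
    by (simp add: Qb_algebras_def)
  obtain X :: "(complex, 'a set) module" and \<pi>
    where X: "strictly_irreducible A X \<pi>" "equivalent_reps A ideal_space (\<otimes>) X \<pi>"
    by (rule strictly_irreducible_universe[OF normed_algebra_axioms strictly_irreducible_ideal_space])
  obtain Y :: "'a set normed" and \<tau>
    where Y: "banach_space Y" "continuous_rep A Y \<tau>" "strictly_irreducible A Y \<tau>"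
      "equivalent_reps A X \<pi> Y \<tau>"
    using Qb[OF X(1)] by blast
  note reps = strictly_irreducible_ideal_space[unfolded strictly_irreducible_def, THEN conjunct1]
    X(1)[unfolded strictly_irreducible_def, THEN conjunct1]
    Y(3)[unfolded strictly_irreducible_def, THEN conjunct1]
  interpret Y: algebra_rep A Y \<tau>
    using normed_algebra_axioms reps(3) by (rule algebra_repI)
  have e: "e \<in> carrier ideal_space" "e \<noteq> \<zero>\<^bsub>ideal_space\<^esub>" "e \<otimes> e = 1 \<odot>\<^bsub>ideal_space\<^esub> e"
    using e_in_ideal_space e_nonzero by simp_all
  obtain x where x: "x \<in> carrier X" "x \<noteq> \<zero>\<^bsub>X\<^esub>" "\<pi> e x = 1 \<odot>\<^bsub>X\<^esub> x"
    by (rule equivalent_reps_eigenvector[OF normed_algebra_axioms reps(1,2) X(2) e_closed e])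
  obtain y where y: "y \<in> carrier Y" "y \<noteq> \<zero>\<^bsub>Y\<^esub>" "\<tau> e y = 1 \<odot>\<^bsub>Y\<^esub> y"
    by (rule equivalent_reps_eigenvector[OF normed_algebra_axioms reps(2,3) Y(4) e_closed x])
  then show False
    using banach_rep_kills_e[OF Y(1-3) y(1)] by simp
qed

text \<open>
  Adjoining a unit does not enlarge the left ideal, since \<open>(a + s1)e = (a + se)e\<close>.
\<close>

lemma coordinatized_left_ideal_unitization:
  "coordinatized_left_ideal (unitization A) (e, 0) (\<lambda>i. (p i, 0)) (\<lambda>i. (r i, 0))"
proof -
  let ?U = "unitization A"
  interpret U: normed_algebra ?U
    by (rule normed_algebra_unitization)
  note emb = embed_unitization
  have zero: "\<zero>\<^bsub>?U\<^esub> = (\<zero>, 0)"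
    by (simp add: unitization_ops)
  define d where "d = (\<lambda>u. fst u \<oplus> snd u \<odot> e)"
  have d: "d u \<in> carrier A" "u \<otimes>\<^bsub>?U\<^esub> (e, 0) = (d u \<otimes> e, 0)" if "u \<in> carrier ?U" for u
    using that
    by (simp_all add: d_def carrier_unitization unitization_ops mult_l_distr smult_mult mult_closed)
  have pd: "(p i, 0) \<otimes>\<^bsub>?U\<^esub> (u \<otimes>\<^bsub>?U\<^esub> (e, 0)) = (p i \<otimes> (d u \<otimes> e), 0)" if "u \<in> carrier ?U" for u i
    using d[OF that] by (simp add: emb(4) mult_closed)
  show ?thesis
  proof
    fix u i assume u: "u \<in> carrier ?U"
    show "\<exists>c. (p i, 0) \<otimes>\<^bsub>?U\<^esub> (u \<otimes>\<^bsub>?U\<^esub> (e, 0)) = c \<odot>\<^bsub>?U\<^esub> (e, 0)"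
      using coordinate_scalar[OF d(1)[OF u], of i] u by (auto simp: pd emb(2))
    show "\<exists>i. (p i, 0) \<otimes>\<^bsub>?U\<^esub> (u \<otimes>\<^bsub>?U\<^esub> (e, 0)) = \<zero>\<^bsub>?U\<^esub>"
      using coordinate_vanishes[OF d(1)[OF u]] u by (simp add: pd zero)
  next
    fix u assume u: "u \<in> carrier ?U" "u \<otimes>\<^bsub>?U\<^esub> (e, 0) \<noteq> \<zero>\<^bsub>?U\<^esub>"
    then have "d u \<otimes> e \<noteq> \<zero>"
      by (simp add: d(2)[OF u(1)] zero)
    then show "\<exists>i. (p i, 0) \<otimes>\<^bsub>?U\<^esub> (u \<otimes>\<^bsub>?U\<^esub> (e, 0)) \<noteq> \<zero>\<^bsub>?U\<^esub>"
      using coordinates_separate[OF d(1)[OF u(1)]] by (simp add: pd[OF u(1)] zero)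
  qed (simp_all add: emb zero e_nonzero p_0 r_0 p_mult_r)
qed

lemma rad_n_psubset_rad_b: "rad_n A \<subset> rad_b A"
proof -
  let ?U = "unitization A"
  interpret U: coordinatized_left_ideal ?U "(e, 0)" "\<lambda>i. (p i, 0)" "\<lambda>i. (r i, 0)"
    by (rule coordinatized_left_ideal_unitization)
  obtain Y :: "('a \<times> complex) set normed" and \<tau>
    where Y: "strictly_irreducible ?U Y \<tau>" "continuous_rep ?U Y \<tau>"
      "rep_kernel ?U Y \<tau> = rep_kernel ?U U.ideal_space (\<otimes>\<^bsub>?U\<^esub>)"
    by (rule continuous_rep_universe[OF normed_algebra_unitization
          U.strictly_irreducible_ideal_space U.continuous_rep_ideal_space]) blast
  have "(e, 0) \<notin> rep_kernel ?U U.ideal_space (\<otimes>\<^bsub>?U\<^esub>)"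
  proof
    assume "(e, 0) \<in> rep_kernel ?U U.ideal_space (\<otimes>\<^bsub>?U\<^esub>)"
    then have "(e, 0) \<otimes>\<^bsub>?U\<^esub> (e, 0) = \<zero>\<^bsub>U.ideal_space\<^esub>"
      using U.e_in_ideal_space unfolding rep_kernel_def by blast
    then show False
      using U.e_idem U.e_nonzero by (simp only: U.ideal_space_simps(2))
  qed
  then have "(e, 0) \<notin> rad_n A"
    unfolding rad_n_def using Y by blast
  moreover have "(e, 0) \<in> rep_kernel ?U X \<pi>"
    if "banach_space X \<and> continuous_rep ?U X \<pi> \<and> strictly_irreducible ?U X \<pi>"
    for X :: "('a \<times> complex) set normed" and \<pi>
    unfolding rep_kernel_def
  proof (intro CollectI conjI ballI)
    fix x assume "x \<in> carrier X"
    then show "\<pi> (e, 0) x = \<zero>\<^bsub>X\<^esub>"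
      using that U.banach_rep_kills_e[of X \<pi> x] by simp
  qed (rule U.e_closed)
  then have "(e, 0) \<in> rad_b A"
    unfolding rad_b_def using U.e_closed by blast
  moreover have "rad_n A \<subseteq> rad_b A"
    unfolding rad_n_def rad_b_def by blast
  ultimately show ?thesis
    by blast
qed

end

section \<open>The algebra of finite matrices\<close>

definition supported :: "nat \<Rightarrow> (nat \<Rightarrow> nat \<Rightarrow> complex) \<Rightarrow> bool"
  where "supported n a \<longleftrightarrow> (\<forall>i j. n \<le> i \<or> n \<le> j \<longrightarrow> a i j = 0)"

text \<open>
  The norm is the sum of the absolute values of all entries. The sums run over all indices, so that
  a matrix need not carry the size of its support. There is no unit, hence no value for \<open>one\<close>.
\<close>

definition finite_matrices :: "(nat \<Rightarrow> nat \<Rightarrow> complex) normed"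
  where "finite_matrices =
    \<lparr>carrier = {a. \<exists>n. supported n a},
     mult = (\<lambda>a b i k. \<Sum>j. a i j * b j k),
     one = undefined,
     zero = (\<lambda>i j. 0),
     add = (\<lambda>a b i j. a i j + b i j),
     smult = (\<lambda>c a i j. c * a i j),
     nrm = (\<lambda>a. \<Sum>i. \<Sum>j. cmod (a i j))\<rparr>"

lemma supported_mono: "\<lbrakk>supported n a; n \<le> m\<rbrakk> \<Longrightarrow> supported m a"
  by (auto simp: supported_def)

lemma finite_matrices_simps:
  "a \<in> carrier finite_matrices \<longleftrightarrow> (\<exists>n. supported n a)"
  "a \<oplus>\<^bsub>finite_matrices\<^esub> b = (\<lambda>i j. a i j + b i j)"
  "c \<odot>\<^bsub>finite_matrices\<^esub> a = (\<lambda>i j. c * a i j)"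
  "\<zero>\<^bsub>finite_matrices\<^esub> = (\<lambda>i j. 0)"
  by (simp_all add: finite_matrices_def)

lemma finite_matrices_mult:
  assumes "supported n a \<or> supported n b"
  shows "(a \<otimes>\<^bsub>finite_matrices\<^esub> b) i k = (\<Sum>j<n. a i j * b j k)"
proof -
  have "(\<Sum>j. a i j * b j k) = (\<Sum>j<n. a i j * b j k)"
    by (rule suminf_finite) (use assms in \<open>auto simp: supported_def\<close>)
  then show ?thesis
    by (simp add: finite_matrices_def)
qed

lemma finite_matrices_nrm:
  assumes "supported n a"
  shows "nrm finite_matrices a = (\<Sum>i<n. \<Sum>j<n. cmod (a i j))"
proof -
  have "(\<Sum>j. cmod (a i j)) = (\<Sum>j<n. cmod (a i j))" for i
    by (rule suminf_finite) (use assms in \<open>auto simp: supported_def\<close>)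
  moreover have "(\<Sum>i. \<Sum>j<n. cmod (a i j)) = (\<Sum>i<n. \<Sum>j<n. cmod (a i j))"
    by (rule suminf_finite) (use assms in \<open>auto simp: supported_def\<close>)
  ultimately show ?thesis
    by (simp add: finite_matrices_def)
qed

lemma supported_ops:
  assumes "supported n a"
  shows "supported n (c \<odot>\<^bsub>finite_matrices\<^esub> a)"
    and "supported n b \<Longrightarrow> supported n (a \<oplus>\<^bsub>finite_matrices\<^esub> b)"
    and "supported n b \<Longrightarrow> supported n (a \<otimes>\<^bsub>finite_matrices\<^esub> b)"
proof -
  show "supported n (c \<odot>\<^bsub>finite_matrices\<^esub> a)"
    "supported n b \<Longrightarrow> supported n (a \<oplus>\<^bsub>finite_matrices\<^esub> b)"
    using assms by (auto simp: supported_def finite_matrices_simps)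
  assume "supported n b"
  then show "supported n (a \<otimes>\<^bsub>finite_matrices\<^esub> b)"
    using assms unfolding supported_def finite_matrices_mult[OF disjI1[OF assms]] by auto
qed

lemma common_support:
  assumes "a \<in> carrier finite_matrices" "b \<in> carrier finite_matrices"
  obtains n where "supported n a" "supported n b"
proof -
  obtain m k where "supported m a" "supported k b"
    using assms by (auto simp: finite_matrices_simps)
  then show thesis
    using that[of "max m k"] by (meson supported_mono max.cobounded1 max.cobounded2)
qed

lemma cmod_entry_le_nrm:
  assumes "supported n a"
  shows "cmod (a i j) \<le> nrm finite_matrices a"
proof (cases "i < n \<and> j < n")
  case True
  then have "cmod (a i j) \<le> (\<Sum>j<n. cmod (a i j))"
    by (intro member_le_sum) auto
  also have "\<dots> \<le> (\<Sum>i<n. \<Sum>j<n. cmod (a i j))"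
    using True by (intro member_le_sum[of i _ "\<lambda>i. \<Sum>j<n. cmod (a i j)"]) (auto intro: sum_nonneg)
  finally show ?thesis
    by (simp add: finite_matrices_nrm[OF assms])
next
  case False
  then have "a i j = 0"
    using assms by (auto simp: supported_def)
  then show ?thesis
    by (simp add: finite_matrices_nrm[OF assms] sum_nonneg)
qed

lemma nrm_finite_matrices_mult_le:
  assumes a: "supported n a" and b: "supported n b"
  shows "nrm finite_matrices (a \<otimes>\<^bsub>finite_matrices\<^esub> b) \<le> nrm finite_matrices a * nrm finite_matrices b"
proof -
  have row: "(\<Sum>k<n. cmod (b j k)) \<le> nrm finite_matrices b" if "j < n" for j
    unfolding finite_matrices_nrm[OF b]
    using that by (intro member_le_sum[of j _ "\<lambda>j. \<Sum>k<n. cmod (b j k)"]) (auto intro: sum_nonneg)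
  have "nrm finite_matrices (a \<otimes>\<^bsub>finite_matrices\<^esub> b) = (\<Sum>i<n. \<Sum>k<n. cmod (\<Sum>j<n. a i j * b j k))"
    by (simp add: finite_matrices_nrm[OF supported_ops(3)[OF a b]] finite_matrices_mult[OF disjI1[OF a]])
  also have "\<dots> \<le> (\<Sum>i<n. \<Sum>k<n. \<Sum>j<n. cmod (a i j) * cmod (b j k))"
    by (intro sum_mono order.trans[OF norm_sum]) (simp add: norm_mult)
  also have "\<dots> = (\<Sum>i<n. \<Sum>j<n. cmod (a i j) * (\<Sum>k<n. cmod (b j k)))"
    unfolding sum_distrib_left by (intro sum.cong refl sum.swap)
  also have "\<dots> \<le> (\<Sum>i<n. \<Sum>j<n. cmod (a i j) * nrm finite_matrices b)"
    by (intro sum_mono mult_left_mono row) auto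
  also have "\<dots> = nrm finite_matrices a * nrm finite_matrices b"
    by (simp add: finite_matrices_nrm[OF a] sum_distrib_right)
  finally show ?thesis .
qed

lemma normed_algebra_finite_matrices: "normed_algebra finite_matrices"
proof -
  let ?A = finite_matrices
  note simps = finite_matrices_simps
  have zero: "supported 0 \<zero>\<^bsub>?A\<^esub>"
    by (simp add: supported_def simps)
  have scl: "c \<odot>\<^bsub>?A\<^esub> a \<in> carrier ?A" if "a \<in> carrier ?A" for c a
    using that supported_ops(1) unfolding simps(1) by blast
  have acl: "a \<oplus>\<^bsub>?A\<^esub> b \<in> carrier ?A" and mcl: "a \<otimes>\<^bsub>?A\<^esub> b \<in> carrier ?A"
    if ab: "a \<in> carrier ?A" "b \<in> carrier ?A" for a b
    using common_support[OF ab] supported_ops(2,3) unfolding simps(1) by metis+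
  have "module complex_field ?A"
  proof (rule moduleI)
    show "abelian_group ?A"
    proof (rule abelian_groupI)
      show "\<zero>\<^bsub>?A\<^esub> \<in> carrier ?A"
        using zero unfolding simps(1) by blast
      show "\<exists>b\<in>carrier ?A. b \<oplus>\<^bsub>?A\<^esub> a = \<zero>\<^bsub>?A\<^esub>" if "a \<in> carrier ?A" for a
        using scl[OF that, of "- 1"] by (rule bexI[rotated]) (simp add: simps)
    qed (simp_all add: acl, simp_all add: simps algebra_simps)
  qed (simp_all add: cring_complex_field scl, simp_all add: simps algebra_simps)
  moreover have "normed_space_axioms ?A"
  proof
    fix a c assume "a \<in> carrier ?A"
    then obtain n where n: "supported n a"
      by (auto simp: simps)
    show "nrm ?A a = 0 \<longleftrightarrow> a = \<zero>\<^bsub>?A\<^esub>"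
    proof
      assume "nrm ?A a = 0"
      then show "a = \<zero>\<^bsub>?A\<^esub>"
        using cmod_entry_le_nrm[OF n] by (simp add: simps fun_eq_iff)
    qed (simp add: finite_matrices_nrm[OF zero])
    show "nrm ?A (c \<odot>\<^bsub>?A\<^esub> a) = cmod c * nrm ?A a"
      unfolding finite_matrices_nrm[OF n] finite_matrices_nrm[OF supported_ops(1)[OF n]]
      by (simp add: simps norm_mult sum_distrib_left)
  next
    fix a b assume "a \<in> carrier ?A" "b \<in> carrier ?A"
    then obtain n where n: "supported n a" "supported n b"
      by (rule common_support)
    have "nrm ?A (a \<oplus>\<^bsub>?A\<^esub> b) = (\<Sum>i<n. \<Sum>j<n. cmod (a i j + b i j))"
      unfolding finite_matrices_nrm[OF supported_ops(2)[OF n]] by (simp add: simps)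
    also have "\<dots> \<le> (\<Sum>i<n. \<Sum>j<n. cmod (a i j) + cmod (b i j))"
      by (intro sum_mono norm_triangle_ineq)
    also have "\<dots> = nrm ?A a + nrm ?A b"
      by (simp add: finite_matrices_nrm[OF n(1)] finite_matrices_nrm[OF n(2)] sum.distrib)
    finally show "nrm ?A (a \<oplus>\<^bsub>?A\<^esub> b) \<le> nrm ?A a + nrm ?A b" .
  qed
  moreover have "normed_algebra_axioms ?A"
  proof
    fix a b s assume ab: "a \<in> carrier ?A" "b \<in> carrier ?A"
    then obtain n where n: "supported n a" "supported n b"
      by (rule common_support)
    show "a \<otimes>\<^bsub>?A\<^esub> b \<in> carrier ?A"
      using ab by (rule mcl)
    show "(s \<odot>\<^bsub>?A\<^esub> a) \<otimes>\<^bsub>?A\<^esub> b = s \<odot>\<^bsub>?A\<^esub> (a \<otimes>\<^bsub>?A\<^esub> b)"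
      "a \<otimes>\<^bsub>?A\<^esub> (s \<odot>\<^bsub>?A\<^esub> b) = s \<odot>\<^bsub>?A\<^esub> (a \<otimes>\<^bsub>?A\<^esub> b)"
      using n by (auto simp: fun_eq_iff finite_matrices_mult[of n] simps sum_distrib_left algebra_simps)
    show "nrm ?A (a \<otimes>\<^bsub>?A\<^esub> b) \<le> nrm ?A a * nrm ?A b"
      by (rule nrm_finite_matrices_mult_le[OF n])
    fix c assume c: "c \<in> carrier ?A"
    then obtain m where "supported m a" "supported m c"
      using ab by (metis common_support)
    then obtain k where k: "supported k a" "supported k b" "supported k c"
      using n that[of "max m n"] by (meson supported_mono max.cobounded1 max.cobounded2)
    have ab_k: "supported k (a \<otimes>\<^bsub>?A\<^esub> b)"
      using k by (simp add: supported_ops)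
    show "(a \<otimes>\<^bsub>?A\<^esub> b) \<otimes>\<^bsub>?A\<^esub> c = a \<otimes>\<^bsub>?A\<^esub> (b \<otimes>\<^bsub>?A\<^esub> c)"
    proof (intro ext)
      fix i l
      have "((a \<otimes>\<^bsub>?A\<^esub> b) \<otimes>\<^bsub>?A\<^esub> c) i l = (\<Sum>j<k. \<Sum>h<k. a i h * b h j * c j l)"
        using k ab_k by (simp add: finite_matrices_mult[of k] sum_distrib_right)
      also have "\<dots> = (\<Sum>h<k. \<Sum>j<k. a i h * b h j * c j l)"
        by (rule sum.swap)
      also have "\<dots> = (a \<otimes>\<^bsub>?A\<^esub> (b \<otimes>\<^bsub>?A\<^esub> c)) i l"
        using k by (simp add: finite_matrices_mult[of k] sum_distrib_left mult.assoc)
      finally show "((a \<otimes>\<^bsub>?A\<^esub> b) \<otimes>\<^bsub>?A\<^esub> c) i l = (a \<otimes>\<^bsub>?A\<^esub> (b \<otimes>\<^bsub>?A\<^esub> c)) i l" .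
    qed
    show "(a \<oplus>\<^bsub>?A\<^esub> b) \<otimes>\<^bsub>?A\<^esub> c = a \<otimes>\<^bsub>?A\<^esub> c \<oplus>\<^bsub>?A\<^esub> b \<otimes>\<^bsub>?A\<^esub> c"
      "a \<otimes>\<^bsub>?A\<^esub> (b \<oplus>\<^bsub>?A\<^esub> c) = a \<otimes>\<^bsub>?A\<^esub> b \<oplus>\<^bsub>?A\<^esub> a \<otimes>\<^bsub>?A\<^esub> c"
      using k by (auto simp: fun_eq_iff finite_matrices_mult[of k] simps sum.distrib algebra_simps)
  qed
  ultimately show ?thesis
    by (simp add: normed_algebra_def normed_space_def)
qed

definition mat_unit :: "nat \<Rightarrow> nat \<Rightarrow> nat \<Rightarrow> nat \<Rightarrow> complex"
  where "mat_unit k l = (\<lambda>i j. if i = k \<and> j = l then 1 else 0)"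

lemma mat_unit_closed: "mat_unit k l \<in> carrier finite_matrices"
proof -
  have "supported (Suc (max k l)) (mat_unit k l)"
    by (auto simp: supported_def mat_unit_def)
  then show ?thesis
    unfolding finite_matrices_simps by blast
qed

lemma mat_unit_mult:
  "mat_unit k l \<otimes>\<^bsub>finite_matrices\<^esub> a = (\<lambda>i j. if i = k then a l j else 0)"
  "a \<otimes>\<^bsub>finite_matrices\<^esub> mat_unit k l = (\<lambda>i j. if j = l then a i k else 0)"
proof -
  have "(\<Sum>j. mat_unit k l i j * a j m) = (\<Sum>j\<in>{l}. mat_unit k l i j * a j m)"
    "(\<Sum>j. a i j * mat_unit k l j m) = (\<Sum>j\<in>{k}. a i j * mat_unit k l j m)" for i m
    by (rule suminf_finite; simp add: mat_unit_def)+
  then show "mat_unit k l \<otimes>\<^bsub>finite_matrices\<^esub> a = (\<lambda>i j. if i = k then a l j else 0)"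
    "a \<otimes>\<^bsub>finite_matrices\<^esub> mat_unit k l = (\<lambda>i j. if j = l then a i k else 0)"
    by (auto simp: finite_matrices_def fun_eq_iff mat_unit_def)
qed

lemma coordinatized_left_ideal_finite_matrices:
  "coordinatized_left_ideal finite_matrices (mat_unit 0 0) (mat_unit 0) (\<lambda>i. mat_unit i 0)"
proof -
  interpret normed_algebra finite_matrices
    by (rule normed_algebra_finite_matrices)
  have coord: "mat_unit 0 i \<otimes>\<^bsub>finite_matrices\<^esub> (a \<otimes>\<^bsub>finite_matrices\<^esub> mat_unit 0 0)
      = a i 0 \<odot>\<^bsub>finite_matrices\<^esub> mat_unit 0 0" for a i
    unfolding mat_unit_mult by (auto simp: finite_matrices_simps fun_eq_iff mat_unit_def)
  have orth: "mat_unit 0 i \<otimes>\<^bsub>finite_matrices\<^esub> mat_unit j 0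
      = (if i = j then mat_unit 0 0 else \<zero>\<^bsub>finite_matrices\<^esub>)" for i j
    unfolding mat_unit_mult by (auto simp: finite_matrices_simps fun_eq_iff mat_unit_def)
  have nonzero: "mat_unit 0 0 \<noteq> \<zero>\<^bsub>finite_matrices\<^esub>"
    by (auto simp: mat_unit_def finite_matrices_simps fun_eq_iff)
  show ?thesis
  proof
    fix a assume a: "a \<in> carrier finite_matrices"
    show "\<exists>c. mat_unit 0 i \<otimes>\<^bsub>finite_matrices\<^esub> (a \<otimes>\<^bsub>finite_matrices\<^esub> mat_unit 0 0)
        = c \<odot>\<^bsub>finite_matrices\<^esub> mat_unit 0 0" for i
      using coord by blast
    obtain n where "supported n a"
      using a by (auto simp: finite_matrices_simps)
    then have "a n 0 = 0"
      by (simp add: supported_def)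
    then show "\<exists>i. mat_unit 0 i \<otimes>\<^bsub>finite_matrices\<^esub> (a \<otimes>\<^bsub>finite_matrices\<^esub> mat_unit 0 0)
        = \<zero>\<^bsub>finite_matrices\<^esub>"
      unfolding coord by (intro exI[of _ n]) (simp add: mat_unit_closed)
    assume "a \<otimes>\<^bsub>finite_matrices\<^esub> mat_unit 0 0 \<noteq> \<zero>\<^bsub>finite_matrices\<^esub>"
    then obtain i where "a i 0 \<noteq> 0"
      by (auto simp: mat_unit_mult finite_matrices_simps fun_eq_iff split: if_splits)
    then show "\<exists>i. mat_unit 0 i \<otimes>\<^bsub>finite_matrices\<^esub> (a \<otimes>\<^bsub>finite_matrices\<^esub> mat_unit 0 0)
        \<noteq> \<zero>\<^bsub>finite_matrices\<^esub>"
      unfolding coord using nonzero by (intro exI[of _ i]) (simp add: vs.smult_eq_zero_iff mat_unit_closed)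
  qed (use nonzero in \<open>simp_all add: mat_unit_closed orth\<close>)
qed

lemma finite_matrices_not_unital: "\<not> unital finite_matrices"
proof
  assume "unital finite_matrices"
  then obtain e where e: "e \<in> carrier finite_matrices"
    "\<And>a. a \<in> carrier finite_matrices \<Longrightarrow> e \<otimes>\<^bsub>finite_matrices\<^esub> a = a"
    by (auto simp: unital_def is_unit_of_def)
  then obtain n where n: "supported n e"
    by (auto simp: finite_matrices_simps)
  have "(e \<otimes>\<^bsub>finite_matrices\<^esub> mat_unit n n) n n = mat_unit n n n n"
    using e(2)[OF mat_unit_closed] by simp
  then show False
    using n unfolding mat_unit_mult by (simp add: supported_def mat_unit_def)
qed

text \<open>
  The condition on \<open>c\<close> says that \<open>(1 + c)(1 + b) = 1\<close>. The algebra is not complete, but the Neumann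
  series \<open>c = \<Sum>\<^sub>k (- b)\<^sup>k\<^sup>+\<^sup>1\<close> converges entrywise, and its sum is supported in the same square as \<open>b\<close>.
\<close>

lemma finite_matrices_quasi_inverse:
  assumes b: "b \<in> carrier finite_matrices" "nrm finite_matrices b < 1"
  obtains c where "c \<in> carrier finite_matrices"
    "\<And>i j. (c \<otimes>\<^bsub>finite_matrices\<^esub> b) i j = - c i j - b i j"
proof -
  let ?A = finite_matrices
  interpret normed_algebra ?A
    by (rule normed_algebra_finite_matrices)
  obtain n where n: "supported n b"
    using b by (auto simp: finite_matrices_simps)
  define q where "q = rec_nat ((- 1) \<odot>\<^bsub>?A\<^esub> b) (\<lambda>_ v. (- 1) \<odot>\<^bsub>?A\<^esub> (v \<otimes>\<^bsub>?A\<^esub> b))"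
  have q: "q 0 = (- 1) \<odot>\<^bsub>?A\<^esub> b" "q (Suc k) = (- 1) \<odot>\<^bsub>?A\<^esub> (q k \<otimes>\<^bsub>?A\<^esub> b)" for k
    by (simp_all add: q_def)
  have qn: "supported n (q k)" for k
    by (induction k) (simp_all add: q n supported_ops)
  have qA: "q k \<in> carrier ?A" for k
    using qn finite_matrices_simps(1) by blast
  have "nrm ?A (q k) \<le> nrm ?A b ^ Suc k" for k
  proof (induction k)
    case (Suc k)
    have "nrm ?A (q (Suc k)) \<le> nrm ?A (q k) * nrm ?A b"
      unfolding q using b qA by (simp add: nrm_smult mult_closed nrm_mult_le)
    also have "\<dots> \<le> nrm ?A b ^ Suc k * nrm ?A b"
      using Suc nrm_nonneg[OF b(1)] by (rule mult_right_mono)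
    finally show ?case
      by (simp add: mult.commute)
  qed (use b in \<open>simp add: q nrm_smult\<close>)
  then have entry: "norm (q k i j) \<le> nrm ?A b ^ Suc k" for k i j
    using cmod_entry_le_nrm[OF qn] order.trans by blast
  have "summable (\<lambda>k. nrm ?A b ^ Suc k)"
    using b nrm_nonneg[OF b(1)] by (simp add: summable_mult summable_geometric)
  then have summ: "summable (\<lambda>k. q k i j)" for i j
    using entry by (rule summable_comparison_test'[where N = 0])
  define c where "c = (\<lambda>i j. \<Sum>k. q k i j)"
  have cn: "supported n c"
    using qn by (simp add: supported_def c_def)
  show thesis
  proof (rule that)
    show "c \<in> carrier ?A"
      using cn finite_matrices_simps(1) by blast
    fix i j
    have step: "(\<Sum>l<n. q k i l * b l j) = - q (Suc k) i j" for k
      by (simp add: q finite_matrices_simps finite_matrices_mult[OF disjI1[OF qn]])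
    have "(c \<otimes>\<^bsub>?A\<^esub> b) i j = (\<Sum>l<n. (\<Sum>k. q k i l) * b l j)"
      unfolding finite_matrices_mult[OF disjI1[OF cn]] by (simp add: c_def)
    also have "\<dots> = (\<Sum>l<n. \<Sum>k. q k i l * b l j)"
      by (intro sum.cong refl suminf_mult2 summ)
    also have "\<dots> = (\<Sum>k. \<Sum>l<n. q k i l * b l j)"
      by (intro suminf_sum[symmetric] summable_mult2 summ)
    also have "\<dots> = - (\<Sum>k. q (Suc k) i j)"
      unfolding step using summ[of i j] summable_Suc_iff[of "\<lambda>k. q k i j"] by (intro suminf_minus) simp
    also have "(\<Sum>k. q (Suc k) i j) = c i j - q 0 i j"
      unfolding c_def by (rule suminf_split_head[OF summ])
    finally show "(c \<otimes>\<^bsub>?A\<^esub> b) i j = - c i j - b i j"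
      by (simp add: q finite_matrices_simps)
  qed
qed

lemma finite_matrices_Q_algebra: "finite_matrices \<in> Q_algebras"
proof -
  let ?A = finite_matrices
  let ?U = "unitization ?A"
  interpret normed_algebra ?A
    by (rule normed_algebra_finite_matrices)
  interpret U: normed_algebra ?U
    by (rule normed_algebra_unitization)
  have one: "\<one>\<^bsub>?U\<^esub> = (\<zero>\<^bsub>?A\<^esub>, 1)"
    using finite_matrices_not_unital by (simp add: unitization_def)
  show ?thesis
  proof (rule Q_algebrasI)
    fix x assume x: "x \<in> carrier ?U" and near: "nrm ?U (x \<ominus>\<^bsub>?U\<^esub> \<one>\<^bsub>?U\<^esub>) < 1"
    define a where "a = fst x"
    define s where "s = snd x"
    have a: "a \<in> carrier ?A"
      using x by (simp add: a_def carrier_unitization)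
    have oneU: "\<one>\<^bsub>?U\<^esub> \<in> carrier ?U"
      using is_unit_of_one_unitization by (simp add: is_unit_of_def)
    have "x \<ominus>\<^bsub>?U\<^esub> \<one>\<^bsub>?U\<^esub> = (a, s - 1)"
      using a oneU
      by (simp add: a_minus_def U.vs.neg_eq_smult one unitization_ops a_def s_def)
    then have small: "nrm ?A a + cmod (s - 1) < 1"
      using near by (simp add: unitization_ops)
    have s: "nrm ?A a < cmod s"
      using small norm_triangle_ineq2[of 1 "1 - s"] by (simp add: norm_minus_commute)
    then have s0: "s \<noteq> 0"
      using nrm_nonneg[OF a] by auto
    define b where "b = inverse s \<odot>\<^bsub>?A\<^esub> a"
    have b: "b \<in> carrier ?A" "nrm ?A b < 1"
      using a s s0 by (simp_all add: b_def nrm_smult norm_divide field_simps)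
    have ab: "a = s \<odot>\<^bsub>?A\<^esub> b"
      using a s0 by (simp add: b_def)
    obtain c where c: "c \<in> carrier ?A" "\<And>i j. (c \<otimes>\<^bsub>?A\<^esub> b) i j = - c i j - b i j"
      by (rule finite_matrices_quasi_inverse[OF b]) blast
    \<comment> \<open>The inverse of \<open>x = s(1 + b)\<close> is \<open>s\<^sup>-\<^sup>1(1 + c)\<close>.\<close>
    define y where "y = (inverse s \<odot>\<^bsub>?A\<^esub> c, inverse s)"
    have "(inverse s \<odot>\<^bsub>?A\<^esub> c) \<otimes>\<^bsub>?A\<^esub> a = c \<otimes>\<^bsub>?A\<^esub> b"
      using b c s0 by (simp add: ab smult_mult mult_smult mult_closed)
    moreover have "y \<otimes>\<^bsub>?U\<^esub> x = ((inverse s \<odot>\<^bsub>?A\<^esub> c) \<otimes>\<^bsub>?A\<^esub> a \<oplus>\<^bsub>?A\<^esub>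
        (inverse s \<odot>\<^bsub>?A\<^esub> a \<oplus>\<^bsub>?A\<^esub> s \<odot>\<^bsub>?A\<^esub> (inverse s \<odot>\<^bsub>?A\<^esub> c)), inverse s * s)"
      by (simp only: y_def unitization_ops a_def s_def fst_conv snd_conv)
    ultimately have "y \<otimes>\<^bsub>?U\<^esub> x = (c \<otimes>\<^bsub>?A\<^esub> b \<oplus>\<^bsub>?A\<^esub> (b \<oplus>\<^bsub>?A\<^esub> c), 1)"
      using c(1) s0 by (simp add: b_def[symmetric])
    also have "\<dots> = \<one>\<^bsub>?U\<^esub>"
      unfolding one using c(2) by (simp add: finite_matrices_simps(2,4) fun_eq_iff)
    finally have "y \<otimes>\<^bsub>?U\<^esub> x = \<one>\<^bsub>?U\<^esub>" .
    moreover have "y \<in> carrier ?U"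
      using c finite_matrices_not_unital by (simp add: y_def carrier_unitization)
    ultimately show "\<exists>y\<in>carrier ?U. y \<otimes>\<^bsub>?U\<^esub> x = \<one>\<^bsub>?U\<^esub>"
      by blast
  qed
qed

section \<open>The strict inclusions\<close>

theorem proposition2p27:
  shows "(Qb_algebras :: 'a normed set) \<subseteq> Q_algebras \<and>
    (\<exists>A :: (nat \<Rightarrow> nat \<Rightarrow> complex) normed. A \<in> Q_algebras \<and> A \<notin> Qb_algebras) \<and>
    (\<forall>A :: 'a normed. A \<in> Q_algebras \<longrightarrow> rad_n A \<subseteq> rad_b A) \<and>
    (\<exists>A :: (nat \<Rightarrow> nat \<Rightarrow> complex) normed. A \<in> Q_algebras \<and> rad_n A \<subset> rad_b A)"
proof (intro conjI)
  interpret coordinatized_left_ideal finite_matrices "mat_unit 0 0" "mat_unit 0" "\<lambda>i. mat_unit i 0"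
    by (rule coordinatized_left_ideal_finite_matrices)
  show "(Qb_algebras :: 'a normed set) \<subseteq> Q_algebras"
    using Qb_algebra_is_Q_algebra by blast
  show "\<exists>A :: (nat \<Rightarrow> nat \<Rightarrow> complex) normed. A \<in> Q_algebras \<and> A \<notin> Qb_algebras"
    using finite_matrices_Q_algebra not_Qb_algebra by blast
  show "\<forall>A :: 'a normed. A \<in> Q_algebras \<longrightarrow> rad_n A \<subseteq> rad_b A"
    unfolding rad_n_def rad_b_def by blast
  show "\<exists>A :: (nat \<Rightarrow> nat \<Rightarrow> complex) normed. A \<in> Q_algebras \<and> rad_n A \<subset> rad_b A"
    using finite_matrices_Q_algebra rad_n_psubset_rad_b by blast
qed

end
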